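(* Let $\chi$ be a primitive Dirichlet character modulo $q>1$, let $\kappa\in\{0,1\}$ with $\chi(-1)=(-1)^{\kappa}$, and for each integer $j\geq1$ let $\alpha_j(\chi)$ denote the unique zero of $L'(s,\chi)$ in the strip $\{\sigma+it:-2j-\kappa-1<\sigma<-2j-\kappa+1\}$. Then \[ \alpha_j(\chi)=-2j-\kappa+O\left(\frac{1}{\log(jq)}\right), \] where the implied constant is absolute.
   Context: $L(s,\chi)$ is the Dirichlet $L$-function of $\chi$, $L'(s,\chi)$ its derivative in $s$. It is known (and used in the definition) that $L'(s,\chi)$ has exactly one zero in each such strip for $j\geq1$. *)

theory Defs
  imports "HOL-Complex_Analysis.Complex_Analysis"
begin

definition dirichlet_character :: "nat \<Rightarrow> (int \<Rightarrow> complex) \<Rightarrow> bool" where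
  "dirichlet_character q chi \<longleftrightarrow>
     q > 0 \<and>
     (\<forall>a b. chi (a * b) = chi a * chi b) \<and>
     (\<forall>a. chi (a + int q) = chi a) \<and>
     (\<forall>a. chi a \<noteq> 0 \<longleftrightarrow> coprime a (int q))"

definition primitive_dirichlet_character :: "nat \<Rightarrow> (int \<Rightarrow> complex) \<Rightarrow> bool" where
  "primitive_dirichlet_character q chi \<longleftrightarrow>
     dirichlet_character q chi \<and>
     \<not> (\<exists>d \<psi>. d dvd q \<and> d < q \<and> dirichlet_character d \<psi> \<and>
              (\<forall>a. coprime a (int q) \<longrightarrow> chi a = \<psi> a))"

definition is_dirichlet_L :: "(int \<Rightarrow> complex) \<Rightarrow> (complex \<Rightarrow> complex) \<Rightarrow> bool" where
  "is_dirichlet_L chi f \<longleftrightarrow>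
     f holomorphic_on UNIV \<and>
     (\<forall>s. Re s > 1 \<longrightarrow>
        (\<lambda>n. chi (int (Suc n)) / of_nat (Suc n) powr s) sums f s)"

(* The L-function as the entire continuation of its Dirichlet series. Such a continuation exists
   exactly for non-principal characters (in particular for primitive ones of modulus q > 1);
   for principal characters the value is unspecified, because of the pole at s = 1. *)
definition dirichlet_L :: "(int \<Rightarrow> complex) \<Rightarrow> complex \<Rightarrow> complex" where
  "dirichlet_L chi = (THE f. is_dirichlet_L chi f)"

lemma is_dirichlet_L_unique:
  assumes f: "is_dirichlet_L chi f" and g: "is_dirichlet_L chi g"
  shows "f = g"
proof
  fix z
  have "f z - g z = 0"
  proof (rule analytic_continuation_open[where s = "{s. Re s > 1}" and s' = UNIV
        and f = "\<lambda>z. f z - g z" and g = "\<lambda>_. 0"])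
    show "open {s::complex. Re s > 1}" by (rule open_halfspace_Re_gt)
    have "2 \<in> {s::complex. Re s > 1}" by simp
    then show "{s::complex. Re s > 1} \<noteq> {}" by blast
    show "(\<lambda>z. f z - g z) holomorphic_on UNIV"
      using f g unfolding is_dirichlet_L_def by (auto intro: holomorphic_on_diff)
    show "f w - g w = 0" if "w \<in> {s. Re s > 1}" for w
      using f g that sums_unique2 unfolding is_dirichlet_L_def by fastforce
  qed auto
  then show "f z = g z" by simp
qed

lemma dirichlet_L_eqI: "is_dirichlet_L chi f \<Longrightarrow> dirichlet_L chi = f"
  unfolding dirichlet_L_def by (blast intro: the_equality is_dirichlet_L_unique)

(* \<kappa> is the parity of chi, i.e. chi(-1) = (-1)^\<kappa> with \<kappa> = 0 or 1. *)
definition L_deriv_zero :: "(int \<Rightarrow> complex) \<Rightarrow> nat \<Rightarrow> nat \<Rightarrow> complex" where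
  "L_deriv_zero chi \<kappa> j =
     (THE z. - 2 * real j - real \<kappa> - 1 < Re z \<and> Re z < - 2 * real j - real \<kappa> + 1 \<and>
             deriv (dirichlet_L chi) z = 0)"

end

(* Write chi' for the conjugate character and tau for its Gauss sum. Separability of the Gauss sum
   together with the partial fraction expansion of the cotangent expresses
   tau * (SUM n. chi n * exp (- n t)) as a sum of poles at the frequencies 2 pi n / q weighted by chi' n.
   Taking Mellin transforms of both sides termwise at real 0 < s < 1 gives the functional
   equation, and with it the entire continuation
     L(s, chi) = A(s) * sin (pi (s + kappa) / 2)
   where A(s) is 2 i^kappa / tau * Gamma (1 - s) * (2 pi / q)^(s - 1) * L(1 - s, chi') for Re s < 1.

   With s = -2j - kappa + w and |Re w| < 1, the equation L'(s, chi) = 0 becomes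
     tan (pi w / 2) = (pi / 2) / R,   R = - A'(s) / A(s) = Digamma (1 - s) + log (q / 2 pi) + L'/L(1 - s, chi'),
   and Re R >= log (j q) - O(1). The right-hand side is therefore small on the whole strip, so for
   large j q the map w = (2 / pi) Arctan ((pi / 2) / R) is a contraction, whose only fixed point has size
   O(1 / log (j q)). *)

theory Submission
  imports Defs "HOL-Number_Theory.Number_Theory"
begin


section \<open>Dirichlet characters and Gauss sums\<close>

text \<open>The interval 0 < s < 1 is where both Mellin evaluations are available: the exponential
  side needs s > 0, the pole side s < 1. There the integrals of the absolute values of the single
  terms have a divergent sum on either side. Both series are therefore summed in blocks of length q:
  the weights in a block add up to zero, which gains one order of decay and makes the interchange
  legitimate. The other obstacle is that the strip is unbounded, so the estimate must not depend on
  Im s. Only the real part of R is bounded, and only from below; this suffices because the real part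
  of Digamma is at least its value at a real point to the left, at any height. Principal Arctan
  inverts tan exactly for real parts strictly between -pi/2 and pi/2, which is |Re w| < 1. The fixed
  point equation is thus equivalent to the equation for the zero on the whole strip, with no choice
  of branch. Small values of j q leave only finitely many triples of a character, a parity and an
  index; the constant absorbs them.\<close>

definition periodic_mod :: "nat \<Rightarrow> (int \<Rightarrow> complex) \<Rightarrow> bool" where
  "periodic_mod q f \<longleftrightarrow> (\<forall>a. f (a + int q) = f a)"

lemma periodic_mod_shift:
  assumes "periodic_mod q f"
  shows "f (a + k * int q) = f a"
proof -
  have nat: "f (a + int n * int q) = f a" for n a
  proof (induction n)
    case (Suc n)
    have "a + int (Suc n) * int q = (a + int n * int q) + int q" by (simp add: algebra_simps)
    then show ?case using assms Suc unfolding periodic_mod_def by metis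
  qed simp
  show ?thesis
  proof (cases "k \<ge> 0")
    case True
    then show ?thesis using nat[of a "nat k"] by simp
  next
    case False
    then show ?thesis using nat[of "a + k * int q" "nat (- k)"] by simp
  qed
qed

lemma periodic_mod_cong:
  assumes "periodic_mod q f" "[a = b] (mod int q)"
  shows "f a = f b"
proof -
  from assms(2) obtain k where "b = a + k * int q"
    by (metis cong_iff_lin mult.commute)
  then show ?thesis using periodic_mod_shift[OF assms(1)] by simp
qed

lemma sum_periodic_mult:
  assumes f: "periodic_mod q f" and c: "coprime c (int q)" and q: "q > 0"
  shows "(\<Sum>b\<in>{0..<int q}. f (c * b)) = (\<Sum>b\<in>{0..<int q}. f b)"
proof -
  have "inj_on (\<lambda>b. (c * b) mod int q) {0..<int q}"
  proof (rule inj_onI)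
    fix x y assume xy: "x \<in> {0..<int q}" "y \<in> {0..<int q}" "(c * x) mod int q = (c * y) mod int q"
    then have "[c * x = c * y] (mod int q)" by (simp add: cong_def)
    then have "[x = y] (mod int q)" using c by (simp add: cong_mult_lcancel)
    then show "x = y" using xy by (simp add: cong_def)
  qed
  moreover have "(\<lambda>b. (c * b) mod int q) ` {0..<int q} \<subseteq> {0..<int q}" using q by auto
  ultimately have bij: "bij_betw (\<lambda>b. (c * b) mod int q) {0..<int q} {0..<int q}"
    by (simp add: bij_betw_def endo_inj_surj)
  have "(\<Sum>b\<in>{0..<int q}. f (c * b)) = (\<Sum>b\<in>{0..<int q}. f ((c * b) mod int q))"
    by (intro sum.cong refl periodic_mod_cong[OF f]) (simp add: cong_def)
  also have "\<dots> = (\<Sum>b\<in>{0..<int q}. f b)"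
    by (rule sum.reindex_bij_betw[OF bij])
  finally show ?thesis .
qed

text \<open>Two systems of residues are in use: \<open>{0..<int q}\<close> for Gauss sums, and
  \<open>1..q\<close> for series, where \<open>n * q + a\<close> then runs once through the positive
  integers.\<close>

lemma sum_periodic_nat:
  assumes "periodic_mod q f" "q > 0"
  shows "(\<Sum>b=1..q. f (int b)) = (\<Sum>b\<in>{0..<int q}. f b)"
proof -
  have "(\<Sum>b\<in>{0..<int q}. f b) = (\<Sum>b<q. f (int b))"
    by (rule sum.reindex_bij_witness[where i = int and j = nat]) auto
  also have "\<dots> = f 0 + (\<Sum>b=1..<q. f (int b))"
    using assms(2) by (simp add: lessThan_atLeast0 sum.atLeast_Suc_lessThan)
  also have "\<dots> = (\<Sum>b=1..<q. f (int b)) + f (int q)"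
    using assms(1) unfolding periodic_mod_def by (metis add.commute add_0)
  also have "\<dots> = (\<Sum>b=1..q. f (int b))"
    using assms(2) by (cases q) (auto simp: atLeastLessThanSuc_atLeastAtMost)
  finally show ?thesis by simp
qed

section \<open>Additive characters modulo q and their orthogonality\<close>

definition additive_char :: "nat \<Rightarrow> int \<Rightarrow> complex" where
  "additive_char q x = cis (2 * pi * real_of_int x / real q)"

lemma additive_char_add: "additive_char q (x + y) = additive_char q x * additive_char q y"
  by (simp add: additive_char_def cis_mult add_divide_distrib distrib_left)

lemma additive_char_0 [simp]: "additive_char q 0 = 1"
  by (simp add: additive_char_def)

lemma additive_char_multiple:
  assumes "q > 0" shows "additive_char q (k * int q) = 1"
proof -
  have "2 * pi * real_of_int (k * int q) / real q = 2 * pi * real_of_int k"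
    using assms by simp
  then show ?thesis unfolding additive_char_def by (metis Ints_of_int cis_multiple_2pi)
qed

lemma periodic_mod_mult_additive_char:
  assumes "q > 0" "periodic_mod q f"
  shows "periodic_mod q (\<lambda>b. f b * additive_char q (n * b))"
  unfolding periodic_mod_def
proof
  fix b
  have "additive_char q (n * (b + int q)) = additive_char q (n * b)"
    by (simp add: distrib_left additive_char_add additive_char_multiple[OF assms(1)])
  then show "f (b + int q) * additive_char q (n * (b + int q)) = f b * additive_char q (n * b)"
    using assms(2) by (simp add: periodic_mod_def)
qed

lemma additive_char_neq_1:
  assumes "\<not> int q dvd x" "q > 0"
  shows "additive_char q x \<noteq> 1"
proof
  assume "additive_char q x = 1"
  then have "cos (2 * pi * real_of_int x / real q) = 1"
    by (simp add: additive_char_def complex_eq_iff)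
  then obtain n :: int where "2 * pi * real_of_int x / real q = real_of_int n * 2 * pi"
    by (auto simp: cos_one_2pi_int)
  then have "pi * real_of_int x = pi * (real_of_int n * real q)"
    using assms(2) by (simp add: field_simps)
  then have "real_of_int x = real_of_int n * real q" by simp
  then have "x = n * int q" by (metis of_int_eq_iff of_int_mult of_int_of_nat_eq)
  then show False using assms(1) by simp
qed

lemma sum_additive_char:
  assumes "q > 0"
  shows "(\<Sum>n\<in>{0..<int q}. additive_char q (n * x)) = (if int q dvd x then of_nat q else 0)"
proof (cases "int q dvd x")
  case True
  then have "additive_char q (n * x) = 1" for n
    using assms by (metis additive_char_multiple dvd_def mult.commute mult.left_commute)
  then show ?thesis using True by simp
next
  case False
  have pow: "additive_char q (int n * x) = additive_char q x ^ n" for n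
    by (induction n) (simp_all add: distrib_right additive_char_add)
  have "(\<Sum>n\<in>{0..<int q}. additive_char q (n * x)) = (\<Sum>n<q. additive_char q (int n * x))"
    by (rule sum.reindex_bij_witness[where i = int and j = nat]) auto
  also have "\<dots> = (\<Sum>n<q. additive_char q x ^ n)"
    by (simp add: pow)
  also have "\<dots> = (additive_char q x ^ q - 1) / (additive_char q x - 1)"
    using additive_char_neq_1[OF False assms] by (simp add: geometric_sum)
  also have "additive_char q x ^ q = additive_char q (x * int q)"
    unfolding additive_char_def Complex.DeMoivre using assms by (simp add: field_simps)
  also have "\<dots> = 1" by (rule additive_char_multiple[OF assms])
  finally show ?thesis using False by simp
qed

text \<open>Units modulo \<open>d\<close> lift to units modulo \<open>q\<close>. In
  \<open>a + d * k\<close>, with \<open>k\<close> the product of the primes of \<open>q\<close> not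
  dividing \<open>a\<close>, each prime of \<open>q\<close> divides exactly one of the two summands,
  so it cannot divide the sum.\<close>

lemma coprime_lift_modulus:
  fixes a :: int
  assumes d: "d dvd q" and q: "q > 0" and a: "coprime a (int d)"
  shows "\<exists>x. coprime x (int q) \<and> [x = a] (mod int d)"
proof -
  define P where "P = {p \<in> prime_factors (int q). \<not> p dvd a}"
  define k where "k = \<Prod>P"
  have finP: "finite P" by (simp add: P_def)
  have "coprime (a + int d * k) (int q)"
  proof (rule ccontr)
    assume "\<not> coprime (a + int d * k) (int q)"
    then obtain c where c: "c dvd a + int d * k" "c dvd int q" "\<not> is_unit c"
      by (rule not_coprimeE)
    have "c \<noteq> 0" using c(2) q by auto
    then obtain p where "p dvd c" "prime p" using c(3) prime_divisor_exists by blast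
    then have p: "prime p" "p dvd a + int d * k" "p dvd int q"
      using c by (auto intro: dvd_trans)
    show False
    proof (cases "p dvd a")
      case True
      then have "p dvd int d * k" using p(2) by (simp add: dvd_add_right_iff)
      moreover have "\<not> p dvd int d"
        using True a p(1) by (metis coprime_common_divisor not_prime_unit)
      ultimately have "p dvd k" using p(1) by (simp add: prime_dvd_mult_iff)
      then obtain r where r: "r \<in> P" "p dvd r"
        using p(1) finP unfolding k_def by (auto simp: prime_dvd_prod_iff)
      then have "p = r" using p(1) unfolding P_def
        by (metis (no_types, lifting) in_prime_factors_imp_prime mem_Collect_eq primes_dvd_imp_eq)
      then show False using r True by (simp add: P_def)
    next
      case False
      then have "p \<in> P" using p q by (simp add: P_def in_prime_factors_iff)
      then have "p dvd k" unfolding k_def using finP by (simp add: dvd_prod_eqI)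
      then show False using False p(2) by (simp add: dvd_add_left_iff)
    qed
  qed
  then show ?thesis by (intro exI[of _ "a + int d * k"]) (simp add: cong_def)
qed

section \<open>Characters modulo q and the Gauss sums of their conjugates\<close>

locale dchar =
  fixes q :: nat and chi :: "int \<Rightarrow> complex"
  assumes q_gt_1: "q > 1" and dirichlet: "dirichlet_character q chi"
begin

lemma q_pos: "q > 0" using q_gt_1 by simp

lemma chi_mult: "chi (a * b) = chi a * chi b"
  using dirichlet by (simp add: dirichlet_character_def)

lemma chi_periodic: "periodic_mod q chi"
  using dirichlet by (simp add: dirichlet_character_def periodic_mod_def)

lemma cnj_chi_periodic: "periodic_mod q (\<lambda>a. cnj (chi a))"
  using chi_periodic by (simp add: periodic_mod_def)

lemma chi_eq_0_iff: "chi a = 0 \<longleftrightarrow> \<not> coprime a (int q)"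
  using dirichlet unfolding dirichlet_character_def by blast

lemma chi_cong: "[a = b] (mod int q) \<Longrightarrow> chi a = chi b"
  by (rule periodic_mod_cong[OF chi_periodic])

lemma chi_1 [simp]: "chi 1 = 1"
proof -
  have "chi 1 = chi 1 * chi 1" using chi_mult[of 1 1] by simp
  moreover have "chi 1 \<noteq> 0" by (simp add: chi_eq_0_iff)
  ultimately show ?thesis by simp
qed

lemma chi_power: "chi (a ^ n) = chi a ^ n"
  by (induction n) (simp_all add: chi_mult)

lemma chi_root_of_unity:
  assumes "coprime a (int q)"
  shows "chi a ^ totient q = 1"
proof -
  define m where "m = nat (a mod int q)"
  have m: "int m = a mod int q" using q_pos by (simp add: m_def)
  have "coprime (int m) (int q)" using assms m q_pos by (simp add: coprime_mod_left_iff)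
  then have "[m ^ totient q = 1] (mod q)" by (intro euler_theorem) simp
  then have "[int m ^ totient q = 1] (mod int q)"
    by (metis cong_int_iff of_nat_1 of_nat_power)
  then have "chi (int m ^ totient q) = chi 1" by (rule chi_cong)
  moreover have "chi (int m) = chi a" by (rule chi_cong) (simp add: m cong_def)
  ultimately show ?thesis by (simp add: chi_power)
qed

lemma norm_chi:
  assumes "coprime a (int q)" shows "norm (chi a) = 1"
  using power_eq_1_iff[OF chi_root_of_unity[OF assms]] q_pos by simp

lemma norm_chi_le: "norm (chi a) \<le> 1"
  using norm_chi[of a] chi_eq_0_iff[of a] by (cases "coprime a (int q)") simp_all

lemma cnj_chi_mult_chi: "coprime a (int q) \<Longrightarrow> cnj (chi a) * chi a = 1"
  by (metis complex_norm_square mult.commute norm_chi of_real_1 power_one)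

text \<open>The conjugate is built in so that separability produces \<open>chi n\<close> itself;
  \<open>gauss 1\<close> is the tau of the overview.\<close>

definition gauss :: "int \<Rightarrow> complex" where
  "gauss n = (\<Sum>b\<in>{0..<int q}. cnj (chi b) * additive_char q (n * b))"

text \<open>Multiplication by a unit \<open>c\<close> permutes the residues over which the Gauss sum
  runs.\<close>

lemma gauss_mult:
  assumes "coprime c (int q)"
  shows "gauss n = cnj (chi c) * gauss (n * c)"
proof -
  have "periodic_mod q (\<lambda>b. cnj (chi b) * additive_char q (n * b))"
    by (rule periodic_mod_mult_additive_char[OF q_pos cnj_chi_periodic])
  from sum_periodic_mult[OF this assms q_pos]
  show ?thesis by (simp add: gauss_def chi_mult sum_distrib_left mult_ac)
qed

lemma gauss_coprime:
  assumes "coprime n (int q)"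
  shows "gauss n = chi n * gauss 1"
proof -
  have "chi n * gauss 1 = (cnj (chi n) * chi n) * gauss n"
    using gauss_mult[OF assms, of 1] by (simp add: mult_ac)
  then show ?thesis by (simp add: cnj_chi_mult_chi[OF assms])
qed

text \<open>Two lifts of one class modulo \<open>d\<close> differ by a unit congruent to 1 modulo
  \<open>d\<close>, where \<open>chi\<close> is 1; hence the value of \<open>chi\<close> at any lift
  defines a character modulo \<open>d\<close>. Read contrapositively, this is how primitivity gets
  used: for a proper divisor \<open>d\<close> some unit \<open>c\<close> congruent to 1 modulo
  \<open>d\<close> has \<open>chi c\<close> different from 1.\<close>

lemma induced_if_trivial_on_kernel:
  assumes d: "d dvd q" and triv: "\<And>c. coprime c (int q) \<Longrightarrow> [c = 1] (mod int d) \<Longrightarrow> chi c = 1"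
  shows "\<exists>\<psi>. dirichlet_character d \<psi> \<and> (\<forall>a. coprime a (int q) \<longrightarrow> chi a = \<psi> a)"
proof -
  have eq: "chi x = chi y"
    if xy: "coprime x (int q)" "coprime y (int q)" "[x = y] (mod int d)" for x y
  proof -
    obtain z where z: "[y * z = 1] (mod int q)" using xy(2) cong_solve_coprime_int by blast
    then have cz: "coprime z (int q)"
      by (metis coprime_iff_invertible_int mult.commute)
    have "[y * z = 1] (mod int d)" using z d by (meson cong_dvd_modulus int_dvd_int_iff)
    then have "[x * z = 1] (mod int d)" using xy(3) by (meson cong_scalar_right cong_trans)
    then have "chi (x * z) = 1" using triv xy(1) cz by simp
    moreover have "chi (y * z) = 1" using chi_cong[OF z] by simp
    moreover have "chi z \<noteq> 0" using cz by (simp add: chi_eq_0_iff)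
    ultimately show ?thesis by (simp add: chi_mult) (metis mult_cancel_right)
  qed
  define lift where "lift a = (SOME x. coprime x (int q) \<and> [x = a] (mod int d))" for a
  define \<psi> where "\<psi> a = (if coprime a (int d) then chi (lift a) else 0)" for a
  have lift: "coprime (lift a) (int q)" "[lift a = a] (mod int d)" if "coprime a (int d)" for a
    using someI_ex[OF coprime_lift_modulus[OF d q_pos that]] by (simp_all add: lift_def)
  have d_pos: "d > 0" using d q_pos by (meson dvd_pos_nat)
  have eqpsi: "\<psi> a = chi x" if "coprime x (int q)" "[x = a] (mod int d)" for a x
  proof -
    have "coprime x (int d)" using that(1) d by (meson coprime_divisors dvd_refl int_dvd_int_iff)
    then have ca: "coprime a (int d)" using that(2) by (metis cong_imp_coprime)
    then show ?thesis
      using lift[OF ca] that eq[of "lift a" x] by (simp add: \<psi>_def) (meson cong_sym cong_trans)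
  qed
  have "dirichlet_character d \<psi>"
    unfolding dirichlet_character_def
  proof (intro conjI allI)
    fix a b
    show "\<psi> (a * b) = \<psi> a * \<psi> b"
    proof (cases "coprime a (int d) \<and> coprime b (int d)")
      case True
      then have "\<psi> (a * b) = chi (lift a * lift b)"
        using lift by (intro eqpsi cong_mult) auto
      then show ?thesis using True by (simp add: chi_mult \<psi>_def)
    qed (auto simp: \<psi>_def)
    show "\<psi> (a + int d) = \<psi> a"
    proof (cases "coprime a (int d)")
      case True
      show ?thesis using lift[OF True] eqpsi[of "lift a" "a + int d"] eqpsi[of "lift a" a]
        by (auto simp: cong_def)
    next
      case False
      then have "\<not> coprime (a + int d) (int d)"
        by (metis add_diff_cancel_right' coprime_iff_gcd_eq_1 gcd.commute gcd_diff1)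
      then show ?thesis using False by (simp add: \<psi>_def)
    qed
    show "(\<psi> a \<noteq> 0) = coprime a (int d)" using lift by (simp add: \<psi>_def chi_eq_0_iff)
  qed (rule d_pos)
  moreover have "chi a = \<psi> a" if "coprime a (int q)" for a using eqpsi[OF that] by simp
  ultimately show ?thesis by blast
qed

end

locale primitive_dchar = dchar +
  assumes primitive: "primitive_dirichlet_character q chi"
begin

text \<open>Let \<open>q = g * d\<close> with \<open>g\<close> the gcd of \<open>n\<close> and
  \<open>q\<close>. If \<open>c\<close> is congruent to 1 modulo \<open>d\<close>, then
  \<open>n * c\<close> and \<open>n\<close> agree modulo \<open>q\<close>, so \<open>gauss n\<close>
  equals itself times \<open>cnj (chi c)\<close>. Primitivity supplies such a \<open>c\<close> with
  \<open>chi c\<close> not 1.\<close>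

lemma gauss_not_coprime:
  assumes "\<not> coprime n (int q)"
  shows "gauss n = 0"
proof -
  define g where "g = nat (gcd n (int q))"
  have g: "int g = gcd n (int q)" by (simp add: g_def)
  have "g dvd q" by (metis g gcd_dvd2 int_dvd_int_iff)
  then obtain d where d: "q = g * d" by (rule dvdE)
  have "g \<noteq> 1" using assms g by (metis coprime_iff_gcd_eq_1 of_nat_1)
  then have "d < q" using d q_pos by (cases g; cases d) auto
  have "d dvd q" using d by simp
  then obtain c where c: "coprime c (int q)" "[c = 1] (mod int d)" "chi c \<noteq> 1"
    using induced_if_trivial_on_kernel[OF \<open>d dvd q\<close>] primitive \<open>d < q\<close>
    unfolding primitive_dirichlet_character_def by blast
  have "int g dvd n" using g by simp
  then obtain m where m: "n = int g * m" by (rule dvdE)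
  from c(2) obtain k where k: "c = 1 + int d * k" by (metis cong_iff_lin cong_sym)
  have "n * c * b = n * b + (m * k * b) * int q" for b
    by (simp add: k m d algebra_simps)
  then have "additive_char q (n * c * b) = additive_char q (n * b)" for b
    by (simp add: additive_char_add additive_char_multiple[OF q_pos])
  then have "gauss (n * c) = gauss n" by (simp add: gauss_def)
  then have "gauss n * (1 - cnj (chi c)) = 0"
    using gauss_mult[OF c(1), of n] by (simp add: algebra_simps)
  moreover have "cnj (chi c) \<noteq> 1" using c(3) by (metis complex_cnj_cnj complex_cnj_one)
  ultimately show ?thesis by simp
qed

lemma gauss_separable: "gauss n = chi n * gauss 1"
proof (cases "coprime n (int q)")
  case True
  then show ?thesis by (rule gauss_coprime)
next
  case False
  then have "gauss n = 0" "chi n = 0" using gauss_not_coprime chi_eq_0_iff by blast+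
  then show ?thesis by simp
qed

text \<open>If \<open>gauss 1\<close> vanished, separability would make all \<open>gauss n\<close>
  vanish; Fourier inversion on the residues modulo \<open>q\<close>, evaluated at 1, would then give
  \<open>q = 0\<close>.\<close>

lemma gauss_1_nonzero: "gauss 1 \<noteq> 0"
proof
  assume "gauss 1 = 0"
  then have "gauss n = 0" for n by (simp add: gauss_separable[of n])
  then have "0 = (\<Sum>n\<in>{0..<int q}. additive_char q (- n) * gauss n)" by simp
  also have "\<dots> = (\<Sum>n\<in>{0..<int q}. \<Sum>b\<in>{0..<int q}. cnj (chi b) * additive_char q (n * (b - 1)))"
    unfolding gauss_def sum_distrib_left
    by (intro sum.cong refl) (simp add: right_diff_distrib additive_char_add[symmetric]
        mult.left_commute)
  also have "\<dots> = (\<Sum>b\<in>{0..<int q}. cnj (chi b) * (\<Sum>n\<in>{0..<int q}. additive_char q (n * (b - 1))))"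
    by (subst sum.swap) (simp add: sum_distrib_left)
  also have "\<dots> = (\<Sum>b\<in>{0..<int q}. if b = 1 then of_nat q else 0)"
  proof (intro sum.cong refl)
    fix b assume b: "b \<in> {0..<int q}"
    have "int q dvd b - 1 \<longleftrightarrow> b = 1"
    proof
      assume "int q dvd b - 1"
      then have "b mod int q = 1 mod int q" by (simp add: mod_eq_dvd_iff)
      then show "b = 1" using b q_gt_1 by simp
    qed simp
    then show "cnj (chi b) * (\<Sum>n\<in>{0..<int q}. additive_char q (n * (b - 1))) =
        (if b = 1 then of_nat q else 0)"
      by (simp add: sum_additive_char[OF q_pos])
  qed
  also have "\<dots> = of_nat q" using q_gt_1 by simp
  finally show False using q_pos by simp
qed

lemma sum_cnj_chi: "(\<Sum>b=1..q. cnj (chi (int b))) = 0"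
proof -
  have "\<not> coprime 0 (int q)" using q_gt_1 by simp
  \<comment> \<open>The plain character sum is the Gauss sum at frequency 0, and 0 is not a unit
    because \<open>q > 1\<close>.\<close>
  then have "gauss 0 = 0" by (rule gauss_not_coprime)
  then show ?thesis using sum_periodic_nat[OF cnj_chi_periodic q_pos] by (simp add: gauss_def)
qed

lemma sum_chi: "(\<Sum>b=1..q. chi (int b)) = 0"
  using arg_cong[OF sum_cnj_chi, of cnj] by simp

lemma gauss_nat: "(\<Sum>b=1..q. cnj (chi (int b)) * additive_char q (n * int b)) = chi n * gauss 1"
proof -
  have "periodic_mod q (\<lambda>b. cnj (chi b) * additive_char q (n * b))"
    by (rule periodic_mod_mult_additive_char[OF q_pos cnj_chi_periodic])
  from sum_periodic_nat[OF this q_pos] show ?thesis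
    by (simp add: gauss_separable[of n, symmetric]) (simp add: gauss_def)
qed

end

text \<open>A character is determined by its values on one period, and these lie in the finite set
  of 0 and the roots of unity of order dividing \<open>totient q\<close>. This makes the exceptional
  set of the final argument finite.\<close>

lemma finite_dirichlet_characters:
  assumes "q > 1"
  shows "finite {chi. dirichlet_character q chi}"
proof (rule finite_imageD)
  let ?R = "\<lambda>chi. restrict chi {0..<int q}"
  let ?V = "insert 0 {z::complex. z ^ totient q = 1}"
  have "?R ` {chi. dirichlet_character q chi} \<subseteq> PiE {0..<int q} (\<lambda>_. ?V)"
  proof (clarsimp simp: PiE_iff)
    fix chi a assume c: "dirichlet_character q chi" "chi a ^ totient q \<noteq> 1"
    interpret dchar q chi using assms c by unfold_locales
    show "chi a = 0" using chi_root_of_unity c(2) chi_eq_0_iff by blast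
  qed
  moreover have "finite ?V"
    using assms by (simp add: finite_roots_unity Suc_leI)
  ultimately show "finite (?R ` {chi. dirichlet_character q chi})"
    by (meson finite_PiE finite_atLeastLessThan_int finite_subset)
  show "inj_on ?R {chi. dirichlet_character q chi}"
  proof (intro inj_onI ext, clarify)
    fix chi chi' a
    assume c: "dirichlet_character q chi" "dirichlet_character q chi'" "?R chi = ?R chi'"
    interpret A: dchar q chi using assms c by unfold_locales
    interpret B: dchar q chi' using assms c by unfold_locales
    have "a mod int q \<in> {0..<int q}" using assms by simp
    then have "chi (a mod int q) = chi' (a mod int q)" using c(3) by (metis restrict_apply)
    moreover have "[a mod int q = a] (mod int q)" by (simp add: cong_def)
    ultimately show "chi a = chi' a" using A.chi_cong B.chi_cong by metis
  qed
qed


section \<open>Dirichlet series of mean-zero periodic functions\<close>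

definition char_block :: "nat \<Rightarrow> (int \<Rightarrow> complex) \<Rightarrow> complex \<Rightarrow> nat \<Rightarrow> complex" where
  "char_block q f s n = (\<Sum>a=1..q. f (int a) * of_nat (n * q + a) powr (- s))"

text \<open>Grouping the Dirichlet series into blocks of length \<open>q\<close> makes it converge absolutely on
  \<open>Re s > 0\<close>, because the coefficients in a block add up to zero.\<close>

definition reg_L :: "nat \<Rightarrow> (int \<Rightarrow> complex) \<Rightarrow> complex \<Rightarrow> complex" where
  "reg_L q f s = (\<Sum>n. char_block q f s n)"

lemma norm_of_real_powr:
  assumes "x > 0" shows "norm (complex_of_real x powr s) = x powr Re s"
  using assms by (simp add: norm_powr_real_powr)

text \<open>Mean value inequality on the real segment from \<open>x\<close> to \<open>y\<close>. The
  derivative has norm \<open>norm s * r powr (- Re s - 1)\<close> at \<open>r\<close>, which is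
  largest at the left end because the exponent is negative. The extra power of \<open>x\<close> is
  the gain exploited for blocks.\<close>

lemma norm_powr_diff_le:
  assumes x: "0 < x" "x \<le> y" and s: "Re s > -1"
  shows "norm (complex_of_real y powr (- s) - complex_of_real x powr (- s))
           \<le> norm s * x powr (- Re s - 1) * (y - x)"
proof -
  let ?S = "closed_segment (complex_of_real x) (complex_of_real y)"
  have seg: "\<exists>r. z = complex_of_real r \<and> x \<le> r" if "z \<in> ?S" for z
    using that x unfolding closed_segment_of_real by (auto simp: closed_segment_eq_real_ivl)
  have "norm (complex_of_real y powr (- s) - complex_of_real x powr (- s))
          \<le> (norm s * x powr (- Re s - 1)) * norm (complex_of_real y - complex_of_real x)"
  proof (rule field_differentiable_bound[where S = ?S
        and f = "\<lambda>z. z powr (- s)" and f' = "\<lambda>z. - s * z powr (- s - 1)"])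
    fix z assume "z \<in> ?S"
    then obtain r where r: "z = complex_of_real r" "x \<le> r" using seg by blast
    then have r0: "r > 0" using x by simp
    then show "((\<lambda>z. z powr (- s)) has_field_derivative - s * z powr (- s - 1)) (at z within ?S)"
      using r by (intro has_field_derivative_at_within[OF has_field_derivative_powr])
        (simp add: complex_nonpos_Reals_iff)
    have "r powr (- Re s - 1) \<le> x powr (- Re s - 1)"
      using r x s by (intro powr_mono2') auto
    then show "norm (- s * z powr (- s - 1)) \<le> norm s * x powr (- Re s - 1)"
      using r r0 by (simp add: norm_mult norm_of_real_powr mult_left_mono)
  qed auto
  also have "norm (complex_of_real y - complex_of_real x) = y - x"
    using x by (simp flip: of_real_diff)
  finally show ?thesis .
qed

text \<open>The value of the Riemann zeta function at 3/2. It bounds the L-functions for real part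
  at least 3/2, which leaves room for Cauchy discs of radius 1/2 around points with real part at
  least 2.\<close>

definition zeta_bound :: real where
  "zeta_bound = (\<Sum>n. real (Suc n) powr (- 3 / 2))"

lemma zeta_bound_summable: "summable (\<lambda>n. real (Suc n) powr (- 3 / 2))"
  by (subst summable_Suc_iff) (simp add: summable_real_powr_iff)

lemma zeta_bound_nonneg: "zeta_bound \<ge> 0"
  unfolding zeta_bound_def by (intro suminf_nonneg zeta_bound_summable) auto

locale mean_zero =
  fixes q :: nat and f :: "int \<Rightarrow> complex"
  assumes q_pos: "q > 0" and norm_le: "norm (f a) \<le> 1"
    and periodic: "periodic_mod q f" and sum_zero: "(\<Sum>a=1..q. f (int a)) = 0"
begin

text \<open>As the weights add up to zero, any constant may be subtracted from \<open>G\<close>, so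
  only its variation over a block counts. This one estimate is applied to powers, to exponentials
  and to pole kernels, each compared with its value at the left end of the block.\<close>

lemma norm_sum_le:
  assumes "\<And>a. a \<in> {1..q} \<Longrightarrow> norm (G a - G0) \<le> B"
  shows "norm (\<Sum>a=1..q. f (int a) * G a) \<le> real q * B"
proof -
  have "(\<Sum>a=1..q. f (int a) * G a) = (\<Sum>a=1..q. f (int a) * (G a - G0))"
    using sum_zero by (simp add: right_diff_distrib sum_subtractf flip: sum_distrib_right)
  also have "norm \<dots> \<le> (\<Sum>a=1..q. B)"
  proof (rule sum_norm_le)
    fix a assume a: "a \<in> {1..q}"
    have "norm (f (int a)) * norm (G a - G0) \<le> 1 * norm (G a - G0)"
      by (intro mult_right_mono norm_le) auto
    then show "norm (f (int a) * (G a - G0)) \<le> B" using assms[OF a] by (simp add: norm_mult)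
  qed
  finally show ?thesis by simp
qed

text \<open>The comparison value is taken at \<open>n * q\<close>, which is positive only for
  \<open>n \<ge> 1\<close>. The resulting exponent \<open>- Re s - 1\<close> is below -1 as soon as
  \<open>Re s > 0\<close>.\<close>

lemma norm_char_block_le:
  assumes s: "Re s > -1" and n: "n \<ge> 1"
  shows "norm (char_block q f s n) \<le> real q ^ 2 * (norm s * real n powr (- Re s - 1))"
proof -
  have nq: "real (n * q) \<ge> real n" unfolding of_nat_le_iff using q_pos by simp
  have "norm (char_block q f s n) \<le> real q * (norm s * real n powr (- Re s - 1) * real q)"
    unfolding char_block_def
  proof (rule norm_sum_le[where ?G0.0 = "of_nat (n * q) powr (- s)"])
    fix a assume a: "a \<in> {1..q}"
    have "norm (complex_of_real (real (n * q + a)) powr (- s) - complex_of_real (real (n * q)) powr (- s))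
        \<le> norm s * real (n * q) powr (- Re s - 1) * (real (n * q + a) - real (n * q))"
      using n q_pos s by (intro norm_powr_diff_le) auto
    also have "\<dots> \<le> norm s * real n powr (- Re s - 1) * real q"
    proof (intro mult_mono mult_left_mono)
      show "real (n * q) powr (- Re s - 1) \<le> real n powr (- Re s - 1)"
        using nq s n by (intro powr_mono2') auto
    qed (use a in auto)
    finally show "norm (of_nat (n * q + a) powr (- s) - of_nat (n * q) powr (- s))
        \<le> norm s * real n powr (- Re s - 1) * real q" by simp
  qed
  then show ?thesis by (simp add: power2_eq_square mult_ac)
qed

lemma reg_L_aux:
  obtains g where "\<And>s. Re s > 0 \<Longrightarrow> char_block q f s sums g s"
    and "g holomorphic_on {s. Re s > 0}"
proof -
  have op: "open {s. Re s > 0}" by (rule open_halfspace_Re_gt)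
  obtain g where g: "\<forall>s\<in>{s. Re s > 0}. ((\<lambda>n. char_block q f s n) sums g s) \<and> g field_differentiable (at s)"
  proof (rule series_differentiable_comparison_complex[OF op, where f = "\<lambda>n s. char_block q f s n"])
    fix n s
    show "(\<lambda>s. char_block q f s n) field_differentiable (at s)"
    proof -
      have "(\<lambda>s. char_block q f s n) holomorphic_on UNIV"
        unfolding char_block_def by (intro holomorphic_intros)
      then show ?thesis by (simp add: holomorphic_on_def)
    qed
  next
    fix x assume "x \<in> {s. Re s > 0}"
    then have x: "Re x > 0" by simp
    \<comment> \<open>On the ball of radius half of \<open>Re x\<close> the real part stays at least
      \<open>d\<close>, which gives one summable majorant for the whole ball.\<close>
    define d where "d = Re x / 2"
    define h where "h n = complex_of_real (real q ^ 2 * ((norm x + d) * real n powr (- d - 1)))" for n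
    have d: "d > 0" using x by (simp add: d_def)
    show "\<exists>d h. 0 < d \<and> summable h \<and> range h \<subseteq> \<real>\<^sub>\<ge>\<^sub>0 \<and>
        (\<forall>\<^sub>F n in sequentially. \<forall>y\<in>ball x d \<inter> {s. Re s > 0}. cmod (char_block q f y n) \<le> cmod (h n))"
    proof (intro exI conjI)
      show "summable h" unfolding h_def
        using d by (intro summable_of_real summable_mult) (simp add: summable_real_powr_iff)
      show "range h \<subseteq> \<real>\<^sub>\<ge>\<^sub>0" using d by (auto simp: h_def simp flip: of_real_mult of_real_power of_real_add)
      show "\<forall>\<^sub>F n in sequentially. \<forall>y\<in>ball x d \<inter> {s. Re s > 0}. cmod (char_block q f y n) \<le> cmod (h n)"
        using eventually_ge_at_top[of 1]
      proof eventually_elim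
        fix n :: nat assume n: "n \<ge> 1"
        show "\<forall>y\<in>ball x d \<inter> {s. Re s > 0}. cmod (char_block q f y n) \<le> cmod (h n)"
        proof
          fix y assume y: "y \<in> ball x d \<inter> {s. Re s > 0}"
          then have yd: "norm (y - x) \<le> d" by (simp add: dist_norm norm_minus_commute)
          have "norm y \<le> norm x + d" using norm_triangle_sub[of y x] yd by simp
          moreover have "Re y \<ge> d" using abs_Re_le_cmod[of "y - x"] yd by (simp add: d_def)
          ultimately have "norm y * real n powr (- Re y - 1) \<le> (norm x + d) * real n powr (- d - 1)"
            using n d by (intro mult_mono powr_mono) auto
          moreover have "norm (char_block q f y n) \<le> real q ^ 2 * (norm y * real n powr (- Re y - 1))"
            using y n by (intro norm_char_block_le) auto
          ultimately have "norm (char_block q f y n) \<le> real q ^ 2 * ((norm x + d) * real n powr (- d - 1))"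
            by (meson mult_left_mono order_trans zero_le_power2)
          also have "\<dots> \<le> norm (h n)" unfolding h_def by (simp only: norm_of_real abs_ge_self)
          finally show "norm (char_block q f y n) \<le> norm (h n)" .
        qed
      qed
    qed (rule d)
  qed
  show thesis
  proof (rule that)
    show "char_block q f s sums g s" if "Re s > 0" for s using g that by auto
    show "g holomorphic_on {s. Re s > 0}"
      using g op by (auto simp: holomorphic_on_open field_differentiable_def)
  qed
qed

lemma reg_L_sums: "Re s > 0 \<Longrightarrow> char_block q f s sums reg_L q f s"
  using reg_L_aux unfolding reg_L_def by (metis sums_summable summable_sums)

lemma reg_L_holomorphic: "reg_L q f holomorphic_on {s. Re s > 0}"
proof -
  obtain g where g: "\<And>s. Re s > 0 \<Longrightarrow> char_block q f s sums g s" "g holomorphic_on {s. Re s > 0}"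
    using reg_L_aux by blast
  have "g s = reg_L q f s" if "Re s > 0" for s
    using g(1)[OF that] by (simp add: reg_L_def sums_iff)
  then show ?thesis using holomorphic_transform[OF g(2)] by simp
qed

lemma Dirichlet_series_sums:
  assumes s: "Re s > 1"
  shows "(\<lambda>n. f (int (Suc n)) / of_nat (Suc n) powr s) sums reg_L q f s"
proof -
  let ?t = "\<lambda>n. f (int (Suc n)) / of_nat (Suc n) powr s"
  have "summable ?t"
  proof (rule summable_comparison_test')
    show "summable (\<lambda>n. real (Suc n) powr (- Re s))"
      using s by (subst summable_Suc_iff) (simp add: summable_real_powr_iff)
    show "norm (?t n) \<le> real (Suc n) powr (- Re s)" for n
      using norm_le[of "int (Suc n)"] norm_of_real_powr[of "real (Suc n)" s]
      by (simp add: norm_divide powr_minus field_simps)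
  qed
  then obtain S where S: "?t sums S" by (auto simp: summable_def)
  have "(\<Sum>m=n*q..<n*q+q. ?t m) = char_block q f s n" for n
  proof -
    have "(\<Sum>m=n*q..<n*q+q. ?t m) = (\<Sum>a=1..q. ?t (n * q + a - 1))"
      by (rule sum.reindex_bij_witness[where i = "\<lambda>a. n * q + a - 1" and j = "\<lambda>m. m + 1 - n * q"]) auto
    also have "\<dots> = char_block q f s n"
      unfolding char_block_def
    proof (intro sum.cong refl)
      fix a assume a: "a \<in> {1..q}"
      then have e: "Suc (n * q + a - 1) = n * q + a" by simp
      have "f (int (n * q + a)) = f (int a)"
        using periodic_mod_shift[OF periodic, of "int a" "int n"] by (simp add: add.commute)
      then show "?t (n * q + a - 1) = f (int a) * of_nat (n * q + a) powr (- s)"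
        unfolding e by (simp only: powr_minus divide_inverse)
    qed
    finally show ?thesis .
  qed
  \<comment> \<open>Bracketing a convergent series does not change its sum, so the blocks agree with
    the Dirichlet series on its half plane of absolute convergence.\<close>
  then have "char_block q f s sums S" using sums_group[OF S q_pos] by simp
  then have "S = reg_L q f s" using reg_L_sums[of s] s by (simp add: sums_iff)
  then show ?thesis using S by simp
qed

lemma norm_term_le:
  assumes "Re s \<ge> c"
  shows "norm (f (int (Suc n)) / of_nat (Suc n) powr s) \<le> real (Suc n) powr (- c)"
proof -
  have "norm (f (int (Suc n)) / of_nat (Suc n) powr s) \<le> real (Suc n) powr (- Re s)"
    using norm_le[of "int (Suc n)"] norm_of_real_powr[of "real (Suc n)" s]
    by (simp add: norm_divide powr_minus field_simps)
  also have "\<dots> \<le> real (Suc n) powr (- c)"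
    using assms by (intro powr_mono) auto
  finally show ?thesis .
qed

lemma norm_reg_L_le:
  assumes "Re s \<ge> 3 / 2"
  shows "norm (reg_L q f s) \<le> zeta_bound"
proof -
  have s: "(\<lambda>n. f (int (Suc n)) / of_nat (Suc n) powr s) sums reg_L q f s"
    using assms by (intro Dirichlet_series_sums) auto
  have b: "norm (f (int (Suc n)) / of_nat (Suc n) powr s) \<le> real (Suc n) powr (- 3 / 2)" for n
    using norm_term_le[OF assms, of n] by simp
  show ?thesis
    unfolding zeta_bound_def sums_unique[OF s] by (rule norm_suminf_le[OF b zeta_bound_summable])
qed

text \<open>The first term is 1, and the remaining ones are at most zeta(2) - 1 in total, which is
  below 3/4.\<close>

lemma norm_reg_L_ge:
  assumes s: "Re s \<ge> 2" and f1: "f 1 = 1"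
  shows "norm (reg_L q f s) \<ge> 1 / 4"
proof -
  let ?t = "\<lambda>n. f (int (Suc n)) / of_nat (Suc n) powr s"
  have s1: "?t sums reg_L q f s"
    using assms by (intro Dirichlet_series_sums) auto
  then have s2: "(\<lambda>n. ?t (Suc n)) sums (reg_L q f s - 1)"
    using f1 by (subst sums_Suc_iff) simp
  have z: "(\<lambda>n. 1 / (real (Suc n))\<^sup>2) sums (pi\<^sup>2 / 6)"
    using inverse_squares_sums by simp
  have z2: "(\<lambda>n. 1 / (real (Suc (Suc n)))\<^sup>2) sums (pi\<^sup>2 / 6 - 1)"
    using z by (subst sums_Suc_iff[of "\<lambda>n. 1 / (real (Suc n))\<^sup>2"]) simp
  have b: "norm (?t (Suc n)) \<le> 1 / (real (Suc (Suc n)))\<^sup>2" for n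
  proof -
    have "real (Suc (Suc n)) powr (- 2) = 1 / (real (Suc (Suc n)))\<^sup>2"
      by (simp add: powr_minus_divide powr_numeral del: of_nat_Suc)
    then show ?thesis using norm_term_le[OF s, of "Suc n"] by simp
  qed
  have "norm (reg_L q f s - 1) \<le> (\<Sum>n. 1 / (real (Suc (Suc n)))\<^sup>2)"
    unfolding sums_unique[OF s2] by (rule norm_suminf_le[OF b sums_summable[OF z2]])
  also have "\<dots> = pi\<^sup>2 / 6 - 1" using z2 by (simp add: sums_iff)
  also have "\<dots> \<le> 3 / 4"
  proof -
    have "pi \<le> 3.2" using pi_less_4 pi_approx by simp
    then have "pi\<^sup>2 \<le> 3.2\<^sup>2" by (intro power_mono) auto
    then show ?thesis by (simp add: power2_eq_square)
  qed
  finally have "norm (reg_L q f s - 1) \<le> 3 / 4" .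
  then show ?thesis using norm_triangle_ineq2[of 1 "1 - reg_L q f s"]
    by (simp add: norm_minus_commute)
qed

text \<open>Cauchy's inequality on the disc of radius 1/2, which stays in the region
  \<open>Re s \<ge> 3 / 2\<close> governed by \<open>zeta_bound\<close>.\<close>

lemma norm_deriv_reg_L_le:
  assumes s: "Re s \<ge> 2"
  shows "norm (deriv (reg_L q f) s) \<le> 2 * zeta_bound"
proof -
  have sub: "Re z \<ge> 3 / 2" if "z \<in> cball s (1 / 2)" for z
    using that s abs_Re_le_cmod[of "s - z"] by (simp add: dist_norm)
  then have "cball s (1 / 2) \<subseteq> {s. Re s > 0}" by fastforce
  then have hol: "reg_L q f holomorphic_on cball s (1 / 2)"
    using reg_L_holomorphic holomorphic_on_subset by blast
  have "norm ((deriv ^^ 1) (reg_L q f) s) \<le> fact 1 * zeta_bound / (1 / 2) ^ 1"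
  proof (rule Cauchy_inequality)
    show "reg_L q f holomorphic_on ball s (1 / 2)"
      using hol by (meson ball_subset_cball holomorphic_on_subset)
    show "continuous_on (cball s (1 / 2)) (reg_L q f)"
      using hol by (rule holomorphic_on_imp_continuous_on)
    show "norm (reg_L q f x) \<le> zeta_bound" if "norm (s - x) = 1 / 2" for x
      using that sub[of x] by (intro norm_reg_L_le) (simp add: dist_norm)
  qed simp
  then show ?thesis by simp
qed

lemma norm_logderiv_reg_L_le:
  assumes s: "Re s \<ge> 2" and f1: "f 1 = 1"
  shows "norm (deriv (reg_L q f) s / reg_L q f s) \<le> 8 * zeta_bound"
proof -
  have "norm (deriv (reg_L q f) s) / norm (reg_L q f s) \<le> 2 * zeta_bound / (1 / 4)"
    using norm_deriv_reg_L_le[OF s] norm_reg_L_ge[OF s f1] zeta_bound_nonneg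
    by (intro frac_le) auto
  then show ?thesis by (simp add: norm_divide)
qed

end


section \<open>Mellin transforms\<close>

text \<open>Change of variables is carried out for absolutely integrable functions, the interchange
  of sum and integral for Bochner integrals; this is the passage between the two.\<close>

lemma has_bochner_integral_positive_half_line:
  fixes h :: "real \<Rightarrow> real"
  assumes "h absolutely_integrable_on {0<..}" "integral {0<..} h = I"
  shows "has_bochner_integral (lebesgue_on {0<..}) h I"
  using assms absolutely_integrable_imp_integrable[of "{0<..}" h]
    lebesgue_integral_eq_integral[of "{0<..}" h]
  by (simp add: has_bochner_integral_iff)

lemma Mellin_exp:
  assumes s: "s > 0" and x: "(x::real) > 0"
  shows "has_bochner_integral (lebesgue_on {0<..})
           (\<lambda>t. t powr (s - 1) * exp (- x * t)) (Gamma s * x powr (- s))"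
proof -
  let ?f = "\<lambda>t::real. t powr (s - 1) / exp t"
  have "(?f has_integral Gamma s) {0<..}"
    using Gamma_integral_real[OF s]
    by (subst has_integral_spike_set_eq[where T = "{0..}"]) (auto intro: negligible_subset[of "{0}"])
  then have f: "?f absolutely_integrable_on {0<..}" "integral {0<..} ?f = Gamma s"
    by (auto intro!: nonnegative_absolutely_integrable_1 simp: has_integral_iff)
  have im: "(\<lambda>t. x * t) ` {0<..} = {0<..}"
  proof (intro equalityI subsetI)
    fix y :: real assume "y \<in> {0<..}"
    then show "y \<in> (\<lambda>t. x * t) ` {0<..}" using x by (intro image_eqI[of _ _ "y / x"]) auto
  qed (use x in auto)
  have "inj_on (\<lambda>t. x * t) {0<..}" using x by (auto simp: inj_on_def)
  then have "(\<lambda>t. \<bar>x\<bar> * ?f (x * t)) absolutely_integrable_on {0<..} \<and>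
        integral {0<..} (\<lambda>t. \<bar>x\<bar> * ?f (x * t)) = Gamma s"
    using f im by (subst has_absolute_integral_change_of_variables_1')
      (auto intro!: derivative_eq_intros)
  then have "has_bochner_integral (lebesgue_on {0<..}) (\<lambda>t. \<bar>x\<bar> * ?f (x * t)) (Gamma s)"
    by (intro has_bochner_integral_positive_half_line) auto
  then have "has_bochner_integral (lebesgue_on {0<..})
      (\<lambda>t. x powr (- s) * (\<bar>x\<bar> * ?f (x * t))) (x powr (- s) * Gamma s)"
    by (intro has_bochner_integral_mult_right)
  also have "?this \<longleftrightarrow> ?thesis"
  proof (intro has_bochner_integral_cong)
    fix t assume "t \<in> space (lebesgue_on {0::real<..})"
    then have t: "t > 0" by simp
    have "x powr (- s) * (x * x powr (s - 1)) = 1"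
      using x by (simp add: powr_diff powr_minus)
    then show "x powr (- s) * (\<bar>x\<bar> * ?f (x * t)) = t powr (s - 1) * exp (- x * t)"
      using x t by (simp add: powr_mult exp_minus divide_inverse mult_ac)
  qed auto
  finally show ?thesis .
qed

lemma Beta_reflection_real:
  assumes "0 < a" "a < (1::real)"
  shows "Beta a (1 - a) = pi / sin (pi * a)"
proof -
  have "complex_of_real (Gamma a * Gamma (1 - a)) = complex_of_real (pi / sin (pi * a))"
    using Gamma_reflection_complex[of "complex_of_real a"] Gamma_complex_of_real[of "1 - a"]
    by (simp add: Gamma_complex_of_real flip: sin_of_real of_real_mult)
  then show ?thesis by (simp only: of_real_eq_iff Beta_def) simp
qed

text \<open>The substitution \<open>y = t\<^sup>2 / (c\<^sup>2 + t\<^sup>2)\<close> maps the half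
  line onto the unit interval and produces the Beta integral with parameters \<open>p / 2\<close>
  and \<open>1 - p / 2\<close>, which Euler's reflection formula evaluates. Both parameters are
  positive exactly for \<open>0 < p < 2\<close>.\<close>

lemma Mellin_quadratic:
  assumes p: "0 < p" "p < 2" and c: "(c::real) > 0"
  shows "has_bochner_integral (lebesgue_on {0<..})
           (\<lambda>t. t powr (p - 1) / (c\<^sup>2 + t\<^sup>2)) (c powr (p - 2) * (pi / (2 * sin (pi * p / 2))))"
proof -
  let ?f = "\<lambda>y::real. y powr (p / 2 - 1) * (1 - y) powr (1 - p / 2 - 1)"
  let ?g = "\<lambda>t::real. t\<^sup>2 / (c\<^sup>2 + t\<^sup>2)"
  let ?g' = "\<lambda>t::real. 2 * t * c\<^sup>2 / (c\<^sup>2 + t\<^sup>2)\<^sup>2"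
  have pos: "c\<^sup>2 + t\<^sup>2 > 0" for t using c by (simp add: add_pos_nonneg)
  have "(?f has_integral Beta (p / 2) (1 - p / 2)) {0..1}"
    using p by (intro has_integral_Beta_real) auto
  then have "(?f has_integral Beta (p / 2) (1 - p / 2)) {0<..<1}"
    by (simp add: has_integral_Icc_iff_Ioo)
  then have f: "?f absolutely_integrable_on {0<..<1}" "integral {0<..<1} ?f = pi / sin (pi * (p / 2))"
    using Beta_reflection_real[of "p / 2"] p
    by (auto intro!: nonnegative_absolutely_integrable_1 simp: has_integral_iff)
  have im: "?g ` {0<..} = {0<..<1}"
  proof (intro equalityI subsetI)
    fix y :: real assume y: "y \<in> {0<..<1}"
    define t where "t = c * sqrt (y / (1 - y))"
    have t: "t > 0" "t\<^sup>2 = c\<^sup>2 * (y / (1 - y))"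
      using y c by (auto simp: t_def power_mult_distrib)
    have "?g t = y" using y c unfolding t(2) by (simp add: field_simps)
    then show "y \<in> ?g ` {0<..}" using t by (intro image_eqI[of _ _ t]) auto
  next
    fix y assume "y \<in> ?g ` {0<..}"
    then show "y \<in> {0<..<1}" using c pos by auto
  qed
  have inj: "inj_on ?g {0<..}"
  proof (rule inj_onI)
    fix x y :: real assume xy: "x \<in> {0<..}" "y \<in> {0<..}" "?g x = ?g y"
    then have "x\<^sup>2 * (c\<^sup>2 + y\<^sup>2) = y\<^sup>2 * (c\<^sup>2 + x\<^sup>2)"
      using pos[of x] pos[of y] by (simp add: frac_eq_eq)
    then have "c\<^sup>2 * x\<^sup>2 = c\<^sup>2 * y\<^sup>2" by (simp add: algebra_simps)
    then show "x = y" using xy c by (simp add: power2_eq_iff)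
  qed
  have der: "(?g has_real_derivative ?g' t) (at t within {0<..})" for t
    using pos[of t] by (auto intro!: derivative_eq_intros simp: field_simps power2_eq_square)
  have "(\<lambda>t. \<bar>?g' t\<bar> * ?f (?g t)) absolutely_integrable_on {0<..} \<and>
        integral {0<..} (\<lambda>t. \<bar>?g' t\<bar> * ?f (?g t)) = pi / sin (pi * (p / 2))"
    using f im inj der by (subst has_absolute_integral_change_of_variables_1') auto
  then have "has_bochner_integral (lebesgue_on {0<..}) (\<lambda>t. \<bar>?g' t\<bar> * ?f (?g t)) (pi / sin (pi * (p / 2)))"
    by (intro has_bochner_integral_positive_half_line) auto
  then have "has_bochner_integral (lebesgue_on {0<..})
      (\<lambda>t. c powr (p - 2) / 2 * (\<bar>?g' t\<bar> * ?f (?g t))) (c powr (p - 2) / 2 * (pi / sin (pi * (p / 2))))"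
    by (intro has_bochner_integral_mult_right)
  also have "?this \<longleftrightarrow> ?thesis"
  proof (intro has_bochner_integral_cong)
    fix t assume "t \<in> space (lebesgue_on {0::real<..})"
    then have t: "t > 0" by simp
    define D where "D = c\<^sup>2 + t\<^sup>2"
    have D: "D > 0" using pos by (simp add: D_def)
    have "1 - ?g t = (D - t\<^sup>2) / D" using D by (simp add: diff_divide_distrib D_def[symmetric])
    then have g1: "1 - ?g t = c\<^sup>2 / D" by (simp add: D_def)
    have "?f (?g t) = (t\<^sup>2 / D) powr (p / 2 - 1) * (c\<^sup>2 / D) powr (- (p / 2))"
      unfolding g1 by (simp add: D_def)
    also have "\<dots> = (t\<^sup>2) powr (p / 2 - 1) * (c\<^sup>2) powr (- (p / 2)) / (D powr (p / 2 - 1) * D powr (- (p / 2)))"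
      using D c t by (simp add: powr_divide)
    also have "D powr (p / 2 - 1) * D powr (- (p / 2)) = 1 / D"
      using D by (subst powr_add[symmetric]) (simp add: powr_minus_divide)
    also have "(t\<^sup>2) powr (p / 2 - 1) = t powr (p - 2)"
      using t by (simp add: powr_powr flip: powr_numeral)
    also have "(c\<^sup>2) powr (- (p / 2)) = c powr (- p)"
      using c by (simp add: powr_powr flip: powr_numeral)
    finally have "?f (?g t) = t powr (p - 2) * c powr (- p) * D" by simp
    moreover have "\<bar>?g' t\<bar> = 2 * t * c\<^sup>2 / D\<^sup>2" using t by (simp add: D_def)
    ultimately have "c powr (p - 2) / 2 * (\<bar>?g' t\<bar> * ?f (?g t)) =
        (c powr (p - 2) * c powr (- p) * c\<^sup>2) * (t * t powr (p - 2)) / D"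
      using D by (simp add: power2_eq_square)
    also have "c powr (p - 2) * c powr (- p) * c\<^sup>2 = 1"
      using c by (simp add: powr_diff powr_minus)
    also have "t * t powr (p - 2) = t powr (p - 1)"
      using t powr_add[of t 1 "p - 2"] by simp
    finally show "c powr (p - 2) / 2 * (\<bar>?g' t\<bar> * ?f (?g t)) = t powr (p - 1) / (c\<^sup>2 + t\<^sup>2)"
      by (simp add: D_def)
  qed auto
  finally show ?thesis .
qed

section \<open>Partial fractions of the cotangent\<close>

text \<open>Logarithmic derivative of Euler's reflection formula: the product of
  \<open>Gamma z\<close> and \<open>Gamma (1 - z)\<close> is differentiated once by the product rule
  and once as \<open>pi / sin (pi * z)\<close>.\<close>

lemma Digamma_reflection:
  fixes z :: complex
  assumes z: "z \<notin> \<int>"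
  shows "Digamma (1 - z) - Digamma z = of_real pi * cot (of_real pi * z)"
proof -
  have nz: "z \<notin> \<int>\<^sub>\<le>\<^sub>0" "1 - z \<notin> \<int>\<^sub>\<le>\<^sub>0"
    using z nonpos_Ints_Int Ints_diff[OF Ints_1, of "1 - z"] by auto
  have sinz: "sin (of_real pi * w) \<noteq> 0" if "w \<notin> \<int>" for w :: complex
  proof
    assume "sin (of_real pi * w) = 0"
    then obtain n :: int where "of_real pi * w = of_real n * of_real pi"
      by (auto simp: sin_eq_0)
    then have "w = of_int n" by simp
    then show False using that by simp
  qed
  let ?G = "\<lambda>z::complex. Gamma z * Gamma (1 - z)"
  have "(?G has_field_derivative
      Gamma z * Digamma z * Gamma (1 - z) - Gamma z * (Gamma (1 - z) * Digamma (1 - z))) (at z)"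
    using nz by (auto intro!: derivative_eq_intros)
  moreover have "?G = (\<lambda>z. of_real pi / sin (of_real pi * z))"
    by (intro ext Gamma_reflection_complex)
  ultimately have "((\<lambda>z. of_real pi / sin (of_real pi * z)) has_field_derivative
      ?G z * (Digamma z - Digamma (1 - z))) (at z)"
    by (simp add: algebra_simps)
  moreover have "((\<lambda>z. of_real pi / sin (of_real pi * z)) has_field_derivative
      - of_real pi * (of_real pi * cos (of_real pi * z)) / (sin (of_real pi * z))\<^sup>2) (at z)"
    using sinz[OF z] by (auto intro!: derivative_eq_intros simp: power2_eq_square)
  ultimately have "?G z * (Digamma z - Digamma (1 - z)) =
      - of_real pi * (of_real pi * cos (of_real pi * z)) / (sin (of_real pi * z))\<^sup>2"
    by (rule DERIV_unique)
  then have "of_real pi / sin (of_real pi * z) * (Digamma z - Digamma (1 - z)) =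
      of_real pi / sin (of_real pi * z) * (- (of_real pi * cot (of_real pi * z)))"
    by (simp add: Gamma_reflection_complex cot_def power2_eq_square)
  then have "Digamma z - Digamma (1 - z) = - (of_real pi * cot (of_real pi * z))"
    using sinz[OF z] by (subst (asm) mult_left_cancel) auto
  then show ?thesis by (simp add: algebra_simps)
qed

text \<open>Difference of two Digamma series. The pole at \<open>-k\<close> is paired with the one
  at \<open>k + 1\<close>, the pairing that fits arguments with real part \<open>b / q\<close>
  between 0 and 1.\<close>

lemma cot_partial_fractions:
  fixes z :: complex
  assumes z: "z \<notin> \<int>"
  shows "(\<lambda>k. 1 / (z + of_nat k) - 1 / (1 - z + of_nat k)) sums (of_real pi * cot (of_real pi * z))"
proof -
  have nz: "z \<noteq> 0" "1 - z \<noteq> 0" using z by auto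
  let ?a = "\<lambda>w n. inverse (of_nat (Suc n)) - inverse (w + of_nat n) :: complex"
  have s: "?a w sums (Digamma w + euler_mascheroni)" if "w \<noteq> 0" for w
    using summable_sums[OF summable_Digamma[OF that]] by (simp add: Digamma_def)
  from sums_diff[OF s[OF nz(2)] s[OF nz(1)]]
  have "(\<lambda>n. ?a (1 - z) n - ?a z n) sums (Digamma (1 - z) - Digamma z)" by simp
  then show ?thesis unfolding Digamma_reflection[OF z] by (simp add: divide_inverse)
qed


section \<open>The functional equation\<close>

locale char_parity = primitive_dchar +
  fixes \<kappa> :: nat
  assumes parity_cases: "\<kappa> \<in> {0, 1}" and parity: "chi (-1) = (-1) ^ \<kappa>"
begin

sublocale mean_zero q chi
  using q_pos norm_chi_le chi_periodic sum_chi by unfold_locales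

sublocale dual: mean_zero q "\<lambda>a. cnj (chi a)"
  using q_pos norm_chi_le cnj_chi_periodic sum_cnj_chi by unfold_locales auto

lemma chi_reflect:
  assumes "b \<le> q"
  shows "cnj (chi (int (q - b))) = (-1) ^ \<kappa> * cnj (chi (int b))"
proof -
  have "chi (int (q - b)) = chi (-1 * int b)"
    using assms by (intro chi_cong) (simp add: cong_iff_dvd_diff of_nat_diff)
  then show ?thesis using parity chi_mult[of "-1" "int b"] by simp
qed

lemma chi_q: "chi (int q) = 0"
  using q_gt_1 by (simp add: chi_eq_0_iff)

text \<open>The closed form of the series of \<open>chi n * exp (- n * t)\<close> over \<open>n \<ge> 1\<close>.\<close>

definition theta :: "real \<Rightarrow> complex" where
  "theta t = (\<Sum>a=1..q. chi (int a) * of_real (exp (- real a * t))) / (1 - of_real (exp (- real q * t)))"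

text \<open>A conjugate pair of poles at distance \<open>c\<close> from the origin. The sign of the
  second one is the parity factor picked up when the residue \<open>q - b\<close> is folded back to
  \<open>b\<close>.\<close>

definition pole_kernel :: "real \<Rightarrow> real \<Rightarrow> complex" where
  "pole_kernel c t = 1 / (of_real t - \<i> * of_real c) + (-1) ^ \<kappa> / (of_real t + \<i> * of_real c)"

text \<open>These are the frequencies 2 pi m / q with m = \<open>k * q + a\<close>; the left end of
  the block, \<open>a = 0\<close>, is 2 pi k and serves as comparison point.\<close>

definition freq :: "nat \<Rightarrow> nat \<Rightarrow> real" where
  "freq k a = 2 * pi * real (k * q + a) / real q"

lemma freq_pos: "a \<ge> 1 \<Longrightarrow> freq k a > 0"
  using q_pos by (simp add: freq_def add_nonneg_pos)

text \<open>With e = exp (2 pi i z), the cotangent term is 1/2 + e / (1 - e), a geometric series in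
  e. Its first \<open>q\<close> powers carry the additive characters, while the ratio
  \<open>e ^ q\<close> no longer depends on \<open>b\<close>. Summing against the conjugate
  character kills the constant 1/2 and turns each power into a Gauss sum.\<close>

lemma gauss_cot_sum:
  assumes t: "t > 0"
  shows "(\<Sum>b=1..q. cnj (chi (int b)) * (\<i> / 2 * cot (of_real pi * (of_real (real b / real q) + \<i> * of_real (t / (2 * pi))))))
           = gauss 1 * theta t"
proof -
  define z where "z b = complex_of_real (real b / real q) + \<i> * of_real (t / (2 * pi))" for b
  define e where "e b = exp (2 * \<i> * of_real pi * z b)" for b :: nat
  have e_eq: "e b = additive_char q (int b) * of_real (exp (- t))" for b
  proof -
    have "2 * \<i> * of_real pi * z b = \<i> * of_real (2 * pi * real b / real q) + of_real (- t)"
      by (simp add: z_def field_simps)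
    then show ?thesis
      by (simp only: e_def additive_char_def exp_add cis_conv_exp exp_of_real of_int_of_nat_eq)
  qed
  have norm_e: "norm (e b) < 1" for b
    using t by (simp add: e_eq norm_mult additive_char_def)
  have pow_e: "e b ^ a = additive_char q (int a * int b) * of_real (exp (- real a * t))" for a b
  proof -
    have "additive_char q (int b) ^ a = additive_char q (int a * int b)"
      by (induction a) (simp_all add: distrib_right additive_char_add)
    then show ?thesis
      by (simp add: e_eq power_mult_distrib flip: exp_of_nat_mult of_real_power)
  qed
  have e_q: "e b ^ q = of_real (exp (- real q * t))" for b
    using additive_char_multiple[OF q_pos, of "int b"] by (simp add: pow_e mult.commute)
  define R where "R = complex_of_real (exp (- real q * t))"
  have R1: "R \<noteq> 1" using t q_pos by (simp add: R_def flip: of_real_exp)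
  have cot_eq: "\<i> / 2 * cot (of_real pi * z b) = 1 / 2 + (\<Sum>a=1..q. e b ^ a) / (1 - R)" for b
  proof -
    define u where "u = exp (\<i> * (of_real pi * z b))"
    have u0: "u \<noteq> 0" by (simp add: u_def)
    have eu: "e b = u * u" by (simp add: e_def u_def algebra_simps flip: exp_add)
    have u1: "1 - u * u \<noteq> 0" using norm_e[of b] by (auto simp: eu)
    have inv: "exp (- (\<i> * (of_real pi * z b))) = 1 / u"
      unfolding u_def by (rule exp_minus[unfolded inverse_eq_divide])
    have "sin (of_real pi * z b) = \<i> * (1 / u - u) / 2"
      unfolding sin_exp_eq' inv by (simp add: u_def)
    also have "\<dots> = \<i> * ((1 - u * u) / (2 * u))" using u0 by (simp add: field_simps)
    finally have sin: "sin (of_real pi * z b) = \<i> * ((1 - u * u) / (2 * u))" .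
    have "cos (of_real pi * z b) = (u + 1 / u) / 2"
      unfolding cos_exp_eq inv by (simp add: u_def)
    also have "\<dots> = (1 + u * u) / (2 * u)" using u0 by (simp add: field_simps)
    finally have "cot (of_real pi * z b) = (1 + u * u) / (\<i> * (1 - u * u))"
      unfolding cot_def sin using u0 by simp
    then have "\<i> / 2 * cot (of_real pi * z b) = (1 + u * u) / (2 * (1 - u * u))"
      by simp
    also have "\<dots> = 1 / 2 + e b / (1 - e b)"
      using u1 unfolding eu by (simp add: divide_simps)
    also have "e b / (1 - e b) = (\<Sum>a=1..q. e b ^ a) / (1 - R)"
    proof -
      have "(\<Sum>a=1..q. e b ^ a) = e b * (\<Sum>a<q. e b ^ a)"
        by (simp add: sum_distrib_left lessThan_atLeast0 sum.atLeast1_atMost_eq)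
      also have "(\<Sum>a<q. e b ^ a) = (1 - R) / (1 - e b)"
        using u1 by (subst sum_gp_strict) (auto simp: eu[symmetric] e_q R_def)
      finally show ?thesis using R1 by simp
    qed
    finally show ?thesis .
  qed
  have "(\<Sum>b=1..q. cnj (chi (int b)) * (\<i> / 2 * cot (of_real pi * z b))) =
      (\<Sum>b=1..q. cnj (chi (int b))) / 2 +
      (\<Sum>b=1..q. \<Sum>a=1..q. cnj (chi (int b)) * e b ^ a) / (1 - R)"
    by (simp only: cot_eq distrib_left sum.distrib sum_distrib_left sum_divide_distrib
        times_divide_eq_right mult_1_right)
  also have "\<dots> = (\<Sum>a=1..q. \<Sum>b=1..q. cnj (chi (int b)) * e b ^ a) / (1 - R)"
    by (subst sum.swap) (simp only: sum_cnj_chi div_0 add_0_left)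
  also have "\<dots> = (\<Sum>a=1..q. of_real (exp (- real a * t)) *
      (\<Sum>b=1..q. cnj (chi (int b)) * additive_char q (int a * int b))) / (1 - R)"
    by (simp add: pow_e sum_distrib_left mult_ac)
  also have "\<dots> = (\<Sum>a=1..q. of_real (exp (- real a * t)) * (chi (int a) * gauss 1)) / (1 - R)"
    by (simp only: gauss_nat)
  also have "\<dots> = gauss 1 * theta t"
    by (simp add: theta_def R_def sum_distrib_left mult_ac)
  finally show ?thesis by (simp add: z_def)
qed

lemma pole_kernel_sums:
  assumes t: "t > 0"
  shows "(\<lambda>k. \<Sum>a=1..q. cnj (chi (int a)) * pole_kernel (freq k a) t) sums (gauss 1 * theta t)"
proof -
  define z where "z b = complex_of_real (real b / real q) + \<i> * of_real (t / (2 * pi))" for b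
  have zI: "z b \<notin> \<int>" for b
  proof
    assume "z b \<in> \<int>"
    then have "Im (z b) = 0" by (auto elim: Ints_cases)
    then show False using t by (simp add: z_def)
  qed
  let ?T = "\<lambda>b k. \<i> / (2 * of_real pi) * (1 / (z b + of_nat k) - 1 / (1 - z b + of_nat k))"
  have T_sums: "?T b sums (\<i> / (2 * of_real pi) * (of_real pi * cot (of_real pi * z b)))" for b
    by (intro sums_mult cot_partial_fractions zI)
  have "(\<lambda>k. \<Sum>b=1..q. cnj (chi (int b)) * ?T b k) sums
      (\<Sum>b=1..q. cnj (chi (int b)) * (\<i> / (2 * of_real pi) * (of_real pi * cot (of_real pi * z b))))"
    by (rule sums_sum, rule sums_mult, rule T_sums)
  also have "(\<Sum>b=1..q. cnj (chi (int b)) * (\<i> / (2 * of_real pi) * (of_real pi * cot (of_real pi * z b))))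
      = gauss 1 * theta t"
    unfolding gauss_cot_sum[OF t, symmetric] by (intro sum.cong refl) (simp add: z_def)
  also have "(\<lambda>k. \<Sum>b=1..q. cnj (chi (int b)) * ?T b k) =
      (\<lambda>k. \<Sum>a=1..q. cnj (chi (int a)) * pole_kernel (freq k a) t)"
  proof
    fix k
    let ?A = "\<lambda>a. 1 / (of_real t - \<i> * complex_of_real (freq k a))"
    let ?B = "\<lambda>a. 1 / (of_real t + \<i> * complex_of_real (freq k a))"
    \<comment> \<open>The term \<open>b = q\<close> has weight zero. Removing it leaves the range
      \<open>1..<q\<close>, which the reflection from \<open>b\<close> to \<open>q - b\<close>
      permutes.\<close>
    have drop: "(\<Sum>b=1..q. cnj (chi (int b)) * h b) = (\<Sum>b=1..<q. cnj (chi (int b)) * h b)" for h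
      using q_pos chi_q by (cases q) (auto simp: atLeastLessThanSuc_atLeastAtMost)
    \<comment> \<open>Rotation and scaling by \<open>\<i> / (2 * pi)\<close> carries the
      integer-spaced poles of the cotangent, as a function of \<open>z\<close>, to poles on the
      imaginary axis of \<open>t\<close>.\<close>
    have T: "?T b k = ?A b + ?B (q - b)" if b: "b \<in> {1..<q}" for b
    proof -
      have f1: "z b + of_nat k = \<i> / (2 * of_real pi) * (of_real t - \<i> * complex_of_real (freq k b))"
        using q_pos by (simp add: z_def freq_def field_simps)
      have f2: "1 - z b + of_nat k = - (\<i> / (2 * of_real pi)) * (of_real t + \<i> * complex_of_real (freq k (q - b)))"
        using q_pos b by (simp add: z_def freq_def of_nat_diff field_simps)
      have gen: "C * (1 / (C * X) - 1 / (- C * Y)) = 1 / X + 1 / Y" if "C \<noteq> 0" for C X Y :: complex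
        using that by (simp add: right_diff_distrib distrib_left)
      show ?thesis unfolding f1 f2 by (rule gen) simp
    qed
    have "(\<Sum>b=1..<q. cnj (chi (int b)) * ?B (q - b)) = (\<Sum>b=1..<q. cnj (chi (int (q - b))) * ?B b)"
      by (rule sum.reindex_bij_witness[where i = "\<lambda>b. q - b" and j = "\<lambda>b. q - b"]) auto
    also have "\<dots> = (\<Sum>b=1..<q. cnj (chi (int b)) * ((-1) ^ \<kappa> * ?B b))"
    proof (intro sum.cong refl)
      fix b assume "b \<in> {1..<q}"
      then have "b \<le> q" by simp
      then show "cnj (chi (int (q - b))) * ?B b = cnj (chi (int b)) * ((-1) ^ \<kappa> * ?B b)"
        by (simp only: chi_reflect mult_ac)
    qed
    finally have B: "(\<Sum>b=1..<q. cnj (chi (int b)) * ?B (q - b)) = \<dots>" .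
    have "(\<Sum>b=1..q. cnj (chi (int b)) * ?T b k) =
        (\<Sum>b=1..<q. cnj (chi (int b)) * (?A b + ?B (q - b)))"
      unfolding drop by (intro sum.cong refl arg_cong2[where f = "(*)"] T)
    also have "\<dots> = (\<Sum>b=1..<q. cnj (chi (int b)) * ?A b) + (\<Sum>b=1..<q. cnj (chi (int b)) * ?B (q - b))"
      by (simp only: distrib_left sum.distrib)
    also have "\<dots> = (\<Sum>b=1..<q. cnj (chi (int b)) * pole_kernel (freq k b) t)"
      unfolding B by (simp add: pole_kernel_def distrib_left flip: sum.distrib)
    also have "\<dots> = (\<Sum>b=1..q. cnj (chi (int b)) * pole_kernel (freq k b) t)"
      by (rule drop[symmetric])
    finally show "(\<Sum>b=1..q. cnj (chi (int b)) * ?T b k) = \<dots>" .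
  qed
  finally show ?thesis .
qed

lemma exp_sums:
  assumes t: "t > 0"
  shows "(\<lambda>n. \<Sum>a=1..q. chi (int a) * of_real (exp (- real (n * q + a) * t))) sums theta t"
    and "summable (\<lambda>n. norm (\<Sum>a=1..q. chi (int a) * of_real (exp (- real (n * q + a) * t))))"
proof -
  define R where "R = exp (- real q * t)"
  have R: "norm R < 1" "norm (complex_of_real R) < 1" using t q_pos by (simp_all add: R_def)
  have eq: "(\<Sum>a=1..q. chi (int a) * of_real (exp (- real (n * q + a) * t))) =
      (\<Sum>a=1..q. chi (int a) * of_real (exp (- real a * t))) * of_real R ^ n" for n
  proof -
    have "exp (- real (n * q + a) * t) = exp (- real a * t) * R ^ n" for a
      by (simp add: R_def algebra_simps flip: exp_of_nat_mult exp_add)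
    then show ?thesis by (simp add: sum_distrib_left sum_distrib_right mult_ac)
  qed
  show "(\<lambda>n. \<Sum>a=1..q. chi (int a) * of_real (exp (- real (n * q + a) * t))) sums theta t"
    unfolding eq theta_def using sums_mult[OF geometric_sums[OF R(2)]]
    by (simp add: R_def)
  show "summable (\<lambda>n. norm (\<Sum>a=1..q. chi (int a) * of_real (exp (- real (n * q + a) * t))))"
    unfolding eq norm_mult norm_power using R
    by (intro summable_mult summable_geometric) simp
qed

end


section \<open>Termwise Mellin transforms of the two expansions\<close>

lemma termwise_integral:
  fixes f :: "nat \<Rightarrow> 'a \<Rightarrow> complex"
  assumes int: "\<And>n. has_bochner_integral M (f n) (I n)"
    and sums: "\<And>t. t \<in> space M \<Longrightarrow> (\<lambda>n. f n t) sums g t"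
    and abs: "\<And>t. t \<in> space M \<Longrightarrow> summable (\<lambda>n. norm (f n t))"
    and bound: "\<And>n. n \<ge> 1 \<Longrightarrow> (\<integral>t. norm (f n t) \<partial>M) \<le> B n" and B: "summable B"
  shows "I sums (\<integral>t. g t \<partial>M)"
proof -
  have "(\<lambda>n. \<integral>t. f n t \<partial>M) sums (\<integral>t. (\<Sum>n. f n t) \<partial>M)"
  proof (rule sums_integral)
    show "summable (\<lambda>n. \<integral>t. norm (f n t) \<partial>M)"
      \<comment> \<open>The comparison starts at 1: in both applications the majorant of the block
        of index 0 is not integrable, and one term does not affect summability.\<close>
      by (rule summable_comparison_test'[OF B, of 1]) (use bound in simp)
  qed (use int abs in \<open>auto simp: has_bochner_integral_iff\<close>)
  also have "(\<lambda>n. \<integral>t. f n t \<partial>M) = I" using int by (auto simp: has_bochner_integral_iff)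
  also have "(\<integral>t. (\<Sum>n. f n t) \<partial>M) = (\<integral>t. g t \<partial>M)"
    using sums by (intro Bochner_Integration.integral_cong refl) (simp add: sums_iff)
  finally show ?thesis .
qed

lemma integral_norm_le:
  fixes f :: "'a \<Rightarrow> complex"
  assumes "has_bochner_integral M f I" "has_bochner_integral M g J"
    and "\<And>t. t \<in> space M \<Longrightarrow> norm (f t) \<le> g t"
  shows "(\<integral>t. norm (f t) \<partial>M) \<le> J"
proof -
  have "(\<integral>t. norm (f t) \<partial>M) \<le> (\<integral>t. g t \<partial>M)"
    using assms by (intro integral_mono integrable_norm)
      (auto simp: has_bochner_integral_iff)
  then show ?thesis using assms(2) by (simp add: has_bochner_integral_iff)
qed

context char_parity
begin

lemma chi_exp_sum_integral:
  assumes s: "s > 0"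
  shows "has_bochner_integral (lebesgue_on {0<..})
      (\<lambda>t. of_real (t powr (s - 1)) * (\<Sum>a=1..q. chi (int a) * of_real (exp (- real (n * q + a) * t))))
      (of_real (Gamma s) * char_block q chi (of_real s) n)"
proof -
  have "has_bochner_integral (lebesgue_on {0<..})
      (\<lambda>t. \<Sum>a=1..q. chi (int a) * of_real (t powr (s - 1) * exp (- real (n * q + a) * t)))
      (\<Sum>a=1..q. chi (int a) * of_real (Gamma s * real (n * q + a) powr (- s)))"
    using s by (intro has_bochner_integral_sum has_bochner_integral_mult_right
        has_bochner_integral_of_real Mellin_exp) (auto intro!: add_nonneg_pos)
  moreover have "(\<Sum>a=1..q. chi (int a) * of_real (Gamma s * real (n * q + a) powr (- s))) =
      of_real (Gamma s) * char_block q chi (of_real s) n"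
    unfolding char_block_def sum_distrib_left
  proof (intro sum.cong refl)
    fix a
    have "of_nat (n * q + a) powr (- complex_of_real s) = complex_of_real (real (n * q + a) powr (- s))"
      using powr_of_real[of "real (n * q + a)" "- s"] by simp
    then show "chi (int a) * of_real (Gamma s * real (n * q + a) powr (- s)) =
        of_real (Gamma s) * (chi (int a) * of_nat (n * q + a) powr (- complex_of_real s))"
      by simp
  qed
  ultimately show ?thesis by (simp add: sum_distrib_left mult_ac)
qed

text \<open>The zero mean gains the factor \<open>t\<close>. It shifts the Mellin exponent from
  \<open>s\<close> to \<open>s + 1\<close>, so that the integrals of the blocks are summable for
  every \<open>s > 0\<close>.\<close>

lemma norm_chi_exp_sum_le:
  assumes t: "t > 0" and n: "n \<ge> 1"
  shows "norm (\<Sum>a=1..q. chi (int a) * of_real (exp (- real (n * q + a) * t)))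
           \<le> real q ^ 2 * (t * exp (- real n * t))"
proof -
  have "norm (\<Sum>a=1..q. chi (int a) * of_real (exp (- real (n * q + a) * t)))
      \<le> real q * (real q * t * exp (- real n * t))"
  proof (rule norm_sum_le[where ?G0.0 = "of_real (exp (- real (n * q) * t))"])
    fix a assume a: "a \<in> {1..q}"
    have "exp (- real (n * q + a) * t) = exp (- real (n * q) * t) * exp (- real a * t)"
      by (simp add: algebra_simps flip: exp_add)
    then have "complex_of_real (exp (- real (n * q + a) * t)) - of_real (exp (- real (n * q) * t))
        = of_real (exp (- real (n * q) * t) * - (1 - exp (- real a * t)))"
      by (simp only: of_real_diff[symmetric]) (simp add: right_diff_distrib)
    then have "norm (complex_of_real (exp (- real (n * q + a) * t)) - of_real (exp (- real (n * q) * t)))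
        = exp (- real (n * q) * t) * \<bar>1 - exp (- real a * t)\<bar>"
      by (simp only: norm_of_real abs_mult abs_minus_cancel abs_exp_cancel)
    also have "\<dots> \<le> exp (- real n * t) * (real q * t)"
    proof (intro mult_mono)
      have "real n * t \<le> real (n * q) * t"
        using q_pos t by (intro mult_right_mono) (simp_all del: of_nat_mult)
      then show "exp (- real (n * q) * t) \<le> exp (- real n * t)" by simp
      have "1 - exp (- real a * t) \<le> real a * t"
        using exp_ge_add_one_self[of "- real a * t"] by simp
      also have "\<dots> \<le> real q * t" using a t by (intro mult_right_mono) auto
      finally show "\<bar>1 - exp (- real a * t)\<bar> \<le> real q * t" using t by simp
    qed (use t in auto)
    finally show "norm (complex_of_real (exp (- real (n * q + a) * t)) - of_real (exp (- real (n * q) * t)))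
        \<le> real q * t * exp (- real n * t)" by (simp add: mult_ac)
  qed
  then show ?thesis by (simp add: power2_eq_square mult_ac)
qed

lemma theta_Mellin_left:
  assumes s: "s > 0"
  shows "(\<lambda>n. of_real (Gamma s) * char_block q chi (of_real s) n) sums
           (\<integral>t. of_real (t powr (s - 1)) * theta t \<partial>lebesgue_on {0<..})"
proof (rule termwise_integral[OF chi_exp_sum_integral[OF s],
      where B = "\<lambda>n. real q ^ 2 * (Gamma (s + 1) * real n powr (- (s + 1)))"])
  show "(\<lambda>n. of_real (t powr (s - 1)) *
      (\<Sum>a=1..q. chi (int a) * of_real (exp (- real (n * q + a) * t)))) sums
      (of_real (t powr (s - 1)) * theta t)" if "t \<in> space (lebesgue_on {0<..})" for t
    using that by (intro sums_mult exp_sums) simp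
  show "summable (\<lambda>n. norm (of_real (t powr (s - 1)) *
      (\<Sum>a=1..q. chi (int a) * of_real (exp (- real (n * q + a) * t)))))"
    if "t \<in> space (lebesgue_on {0<..})" for t
    using that unfolding norm_mult by (intro summable_mult exp_sums) simp
  show "summable (\<lambda>n. real q ^ 2 * (Gamma (s + 1) * real n powr (- (s + 1))))"
    using s by (intro summable_mult) (simp add: summable_real_powr_iff)
  fix n :: nat assume n: "n \<ge> 1"
  have "has_bochner_integral (lebesgue_on {0<..})
      (\<lambda>t. real q ^ 2 * (t powr ((s + 1) - 1) * exp (- real n * t)))
      (real q ^ 2 * (Gamma (s + 1) * real n powr (- (s + 1))))"
    using s n by (intro has_bochner_integral_mult_right Mellin_exp) auto
  then show "(\<integral>t. norm (of_real (t powr (s - 1)) *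
      (\<Sum>a=1..q. chi (int a) * of_real (exp (- real (n * q + a) * t)))) \<partial>lebesgue_on {0<..})
      \<le> real q ^ 2 * (Gamma (s + 1) * real n powr (- (s + 1)))"
  proof (rule integral_norm_le[OF chi_exp_sum_integral[OF s]])
    fix t assume "t \<in> space (lebesgue_on {0::real<..})"
    then have t: "t > 0" by simp
    have "norm (of_real (t powr (s - 1)) *
        (\<Sum>a=1..q. chi (int a) * of_real (exp (- real (n * q + a) * t))))
      \<le> t powr (s - 1) * (real q ^ 2 * (t * exp (- real n * t)))"
      unfolding norm_mult using norm_chi_exp_sum_le[OF t n] by (intro mult_mono) auto
    also have "\<dots> = real q ^ 2 * ((t powr (s - 1) * t) * exp (- real n * t))" by simp
    also have "t powr (s - 1) * t = t powr ((s + 1) - 1)"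
      using t by (simp add: powr_diff)
    finally show "norm (of_real (t powr (s - 1)) *
        (\<Sum>a=1..q. chi (int a) * of_real (exp (- real (n * q + a) * t))))
      \<le> real q ^ 2 * (t powr ((s + 1) - 1) * exp (- real n * t))" .
  qed
qed

lemma pole_kernel_eq:
  assumes "t > 0"
  shows "pole_kernel c t = 2 * \<i> ^ \<kappa> * of_real ((if \<kappa> = 0 then t else c) / (c\<^sup>2 + t\<^sup>2))"
proof -
  have nz: "of_real t - \<i> * complex_of_real c \<noteq> 0" "of_real t + \<i> * complex_of_real c \<noteq> 0"
    using assms by (auto simp: complex_eq_iff)
  have D: "(of_real t - \<i> * complex_of_real c) * (of_real t + \<i> * complex_of_real c) = of_real (c\<^sup>2 + t\<^sup>2)"
    by (simp add: algebra_simps power2_eq_square)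
  have add: "1 / A + e / B = (B + e * A) / (A * B)" if "A \<noteq> 0" "B \<noteq> 0" for A B e :: complex
    using that by (simp add: field_simps)
  have "pole_kernel c t = ((of_real t + \<i> * complex_of_real c) + (-1) ^ \<kappa> * (of_real t - \<i> * complex_of_real c)) /
      of_real (c\<^sup>2 + t\<^sup>2)"
    unfolding pole_kernel_def D[symmetric] by (rule add[OF nz])
  also have "(of_real t + \<i> * complex_of_real c) + (-1) ^ \<kappa> * (of_real t - \<i> * complex_of_real c) =
      2 * \<i> ^ \<kappa> * of_real (if \<kappa> = 0 then t else c)"
    using parity_cases by auto
  finally show ?thesis by simp
qed

lemma pole_kernel_Mellin:
  assumes s: "0 < s" "s < 1" and c: "c > 0"
  shows "has_bochner_integral (lebesgue_on {0<..}) (\<lambda>t. of_real (t powr (s - 1)) * pole_kernel c t)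
           (\<i> ^ \<kappa> * of_real (c powr (s - 1) * (pi / sin (pi * (s + 1 - real \<kappa>) / 2))))"
proof -
  \<comment> \<open>The kernel has numerator \<open>t\<close> for even and \<open>c\<close> for odd
    characters, so the exponent fed to \<open>Mellin_quadratic\<close> is \<open>s + 1\<close> or
    \<open>s\<close>.\<close>
  define p where "p = s + 1 - real \<kappa>"
  have p: "0 < p" "p < 2" using s parity_cases by (auto simp: p_def)
  have "has_bochner_integral (lebesgue_on {0<..})
      (\<lambda>t. \<i> ^ \<kappa> * of_real (2 * c ^ \<kappa> * (t powr (p - 1) / (c\<^sup>2 + t\<^sup>2))))
      (\<i> ^ \<kappa> * of_real (2 * c ^ \<kappa> * (c powr (p - 2) * (pi / (2 * sin (pi * p / 2))))))"
    by (intro has_bochner_integral_mult_right has_bochner_integral_of_real Mellin_quadratic p c)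
  also have "2 * c ^ \<kappa> * (c powr (p - 2) * (pi / (2 * sin (pi * p / 2)))) =
      c powr (s - 1) * (pi / sin (pi * p / 2))"
  proof -
    have "c ^ \<kappa> * c powr (p - 2) = c powr (s - 1)"
      using c by (simp add: p_def powr_diff powr_add flip: powr_realpow)
    then show ?thesis by (simp add: field_simps)
  qed
  also have "has_bochner_integral (lebesgue_on {0<..})
      (\<lambda>t. \<i> ^ \<kappa> * of_real (2 * c ^ \<kappa> * (t powr (p - 1) / (c\<^sup>2 + t\<^sup>2)))) =
    has_bochner_integral (lebesgue_on {0<..}) (\<lambda>t. of_real (t powr (s - 1)) * pole_kernel c t)"
  proof (intro ext has_bochner_integral_cong refl)
    fix t assume "t \<in> space (lebesgue_on {0::real<..})"
    then have t: "t > 0" by simp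
    have "c ^ \<kappa> * t powr (p - 1) = t powr (s - 1) * (if \<kappa> = 0 then t else c)"
      using parity_cases t by (auto simp: p_def powr_diff)
    then have "of_real (c ^ \<kappa> * t powr (p - 1) / (c\<^sup>2 + t\<^sup>2)) =
        complex_of_real (t powr (s - 1) * (if \<kappa> = 0 then t else c) / (c\<^sup>2 + t\<^sup>2))" by simp
    then show "\<i> ^ \<kappa> * of_real (2 * c ^ \<kappa> * (t powr (p - 1) / (c\<^sup>2 + t\<^sup>2))) =
        of_real (t powr (s - 1)) * pole_kernel c t"
      unfolding pole_kernel_eq[OF t] by (simp add: mult_ac)
  qed
  finally show ?thesis by (simp add: p_def)
qed

text \<open>The modulus of each denominator is the square root of
  \<open>c\<^sup>2 + t\<^sup>2\<close>, which increases with \<open>c\<close>, so both may be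
  replaced by those at \<open>c0\<close>; the factor 2 counts the two poles.\<close>

lemma pole_kernel_diff_le:
  assumes t: "t > 0" and c: "0 \<le> c0" "c0 \<le> c"
  shows "norm (pole_kernel c t - pole_kernel c0 t) \<le> 2 * (c - c0) / (c0\<^sup>2 + t\<^sup>2)"
proof -
  have pos: "x\<^sup>2 + t\<^sup>2 > 0" for x using t by (simp add: add_nonneg_pos)
  have one: "norm (1 / (of_real t + \<sigma> * \<i> * complex_of_real c) - 1 / (of_real t + \<sigma> * \<i> * complex_of_real c0))
      \<le> (c - c0) / (c0\<^sup>2 + t\<^sup>2)" if \<sigma>: "\<sigma> = 1 \<or> \<sigma> = -1" for \<sigma>
  proof -
    let ?X = "\<lambda>c. of_real t + \<sigma> * \<i> * complex_of_real c"
    have nX: "norm (?X c) = sqrt (c\<^sup>2 + t\<^sup>2)" for c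
      using \<sigma> by (auto simp: cmod_def add.commute)
    have X0: "?X c \<noteq> 0" for c using t \<sigma> by (auto simp: complex_eq_iff)
    have "1 / ?X c - 1 / ?X c0 = \<sigma> * \<i> * of_real (c0 - c) / (?X c * ?X c0)"
      using X0[of c] X0[of c0] by (simp add: field_simps)
    also have "norm \<dots> = (c - c0) / (sqrt (c\<^sup>2 + t\<^sup>2) * sqrt (c0\<^sup>2 + t\<^sup>2))"
      using \<sigma> c by (auto simp: norm_mult norm_divide nX simp del: of_real_diff)
    also have "\<dots> \<le> (c - c0) / (sqrt (c0\<^sup>2 + t\<^sup>2) * sqrt (c0\<^sup>2 + t\<^sup>2))"
    proof (intro divide_left_mono mult_right_mono)
      show "sqrt (c0\<^sup>2 + t\<^sup>2) \<le> sqrt (c\<^sup>2 + t\<^sup>2)"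
        using c by (intro real_sqrt_le_mono add_right_mono power_mono)
    qed (use c pos in simp_all)
    also have "\<dots> = (c - c0) / (c0\<^sup>2 + t\<^sup>2)" using pos[of c0] by simp
    finally show ?thesis .
  qed
  have "pole_kernel c t - pole_kernel c0 t =
      (1 / (of_real t + (-1) * \<i> * complex_of_real c) - 1 / (of_real t + (-1) * \<i> * complex_of_real c0)) +
      (-1) ^ \<kappa> * (1 / (of_real t + 1 * \<i> * complex_of_real c) - 1 / (of_real t + 1 * \<i> * complex_of_real c0))"
    by (simp add: pole_kernel_def algebra_simps)
  also have "norm \<dots> \<le> (c - c0) / (c0\<^sup>2 + t\<^sup>2) + 1 * ((c - c0) / (c0\<^sup>2 + t\<^sup>2))"
    using one[of "-1"] one[of 1] by (intro norm_triangle_mono) (simp_all add: norm_mult norm_power)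
  finally show ?thesis by simp
qed

text \<open>A block of frequencies has length at most 2 pi above its left end 2 pi k, and the zero
  mean leaves only the variation of the kernel over it.\<close>

lemma norm_pole_sum_le:
  assumes t: "t > 0"
  shows "norm (\<Sum>a=1..q. cnj (chi (int a)) * pole_kernel (freq k a) t)
           \<le> real q * (4 * pi / ((2 * pi * real k)\<^sup>2 + t\<^sup>2))"
proof (rule dual.norm_sum_le[where ?G0.0 = "pole_kernel (2 * pi * real k) t"])
  fix a assume a: "a \<in> {1..q}"
  have f: "freq k a = 2 * pi * real k + 2 * pi * (real a / real q)"
    using q_pos by (simp add: freq_def field_simps)
  have "real a / real q \<le> 1" using a q_pos by simp
  then have d: "2 * pi * (real a / real q) \<le> 2 * pi * 1" by (intro mult_left_mono) auto
  have "norm (pole_kernel (freq k a) t - pole_kernel (2 * pi * real k) t)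
      \<le> 2 * (freq k a - 2 * pi * real k) / ((2 * pi * real k)\<^sup>2 + t\<^sup>2)"
    using t by (intro pole_kernel_diff_le) (auto simp: f)
  also have "\<dots> \<le> 4 * pi / ((2 * pi * real k)\<^sup>2 + t\<^sup>2)"
    using d by (intro divide_right_mono) (auto simp: f)
  finally show "norm (pole_kernel (freq k a) t - pole_kernel (2 * pi * real k) t)
      \<le> 4 * pi / ((2 * pi * real k)\<^sup>2 + t\<^sup>2)" .
qed

lemma pole_sum_Mellin:
  assumes s: "0 < s" "s < 1"
  shows "has_bochner_integral (lebesgue_on {0<..})
      (\<lambda>t. of_real (t powr (s - 1)) * (\<Sum>a=1..q. cnj (chi (int a)) * pole_kernel (freq k a) t))
      (\<i> ^ \<kappa> * of_real ((2 * pi / real q) powr (s - 1) * (pi / sin (pi * (s + 1 - real \<kappa>) / 2))) *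
        char_block q (\<lambda>a. cnj (chi a)) (1 - of_real s) k)"
proof -
  let ?S = "pi / sin (pi * (s + 1 - real \<kappa>) / 2)"
  have "has_bochner_integral (lebesgue_on {0<..})
      (\<lambda>t. \<Sum>a=1..q. cnj (chi (int a)) * (of_real (t powr (s - 1)) * pole_kernel (freq k a) t))
      (\<Sum>a=1..q. cnj (chi (int a)) * (\<i> ^ \<kappa> * of_real (freq k a powr (s - 1) * ?S)))"
    using s by (intro has_bochner_integral_sum has_bochner_integral_mult_right
        pole_kernel_Mellin freq_pos) auto
  moreover have "(\<Sum>a=1..q. cnj (chi (int a)) * (\<i> ^ \<kappa> * of_real (freq k a powr (s - 1) * ?S))) =
      \<i> ^ \<kappa> * of_real ((2 * pi / real q) powr (s - 1) * ?S) *
        char_block q (\<lambda>a. cnj (chi a)) (1 - of_real s) k"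
    unfolding char_block_def sum_distrib_left
  proof (intro sum.cong refl)
    fix a assume "a \<in> {1..q}"
    have "freq k a = (2 * pi / real q) * real (k * q + a)" by (simp add: freq_def)
    then have f: "freq k a powr (s - 1) = (2 * pi / real q) powr (s - 1) * real (k * q + a) powr (s - 1)"
      by (simp only: powr_mult)
    have "of_nat (k * q + a) powr (- (1 - complex_of_real s)) = complex_of_real (real (k * q + a) powr (s - 1))"
      using powr_of_real[of "real (k * q + a)" "s - 1"] by simp
    then show "cnj (chi (int a)) * (\<i> ^ \<kappa> * of_real (freq k a powr (s - 1) * ?S)) =
        \<i> ^ \<kappa> * of_real ((2 * pi / real q) powr (s - 1) * ?S) *
          (cnj (chi (int a)) * of_nat (k * q + a) powr (- (1 - complex_of_real s)))"
      unfolding f by (simp only: of_real_mult mult_ac)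
  qed
  ultimately show ?thesis by (simp add: sum_distrib_left mult_ac)
qed

text \<open>The majorant of a block integrates to a multiple of
  \<open>(2 * pi * real k) powr (s - 2)\<close>, summable because \<open>s < 1\<close>. For
  \<open>k = 0\<close> it would be the divergent integral of a power of \<open>t\<close>, hence the
  exemption of that block.\<close>

lemma theta_Mellin_right:
  assumes s: "0 < s" "s < 1"
  shows "(\<lambda>k. \<i> ^ \<kappa> * of_real ((2 * pi / real q) powr (s - 1) * (pi / sin (pi * (s + 1 - real \<kappa>) / 2))) *
        char_block q (\<lambda>a. cnj (chi a)) (1 - of_real s) k) sums
      (\<integral>t. of_real (t powr (s - 1)) * (gauss 1 * theta t) \<partial>lebesgue_on {0<..})"
proof (rule termwise_integral[OF pole_sum_Mellin[OF s],
      where B = "\<lambda>k. real q * (4 * pi) * ((2 * pi * real k) powr (s - 2) * (pi / (2 * sin (pi * s / 2))))"])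
  show "(\<lambda>k. of_real (t powr (s - 1)) *
      (\<Sum>a=1..q. cnj (chi (int a)) * pole_kernel (freq k a) t)) sums
      (of_real (t powr (s - 1)) * (gauss 1 * theta t))" if "t \<in> space (lebesgue_on {0<..})" for t
    using that by (intro sums_mult pole_kernel_sums) simp
  show "summable (\<lambda>k. norm (of_real (t powr (s - 1)) *
      (\<Sum>a=1..q. cnj (chi (int a)) * pole_kernel (freq k a) t)))"
    if "t \<in> space (lebesgue_on {0<..})" for t
    unfolding norm_mult
  proof (intro summable_mult)
    have t: "t > 0" using that by simp
    show "summable (\<lambda>k. norm (\<Sum>a=1..q. cnj (chi (int a)) * pole_kernel (freq k a) t))"
    proof (rule summable_comparison_test'[where N = 1])
      show "summable (\<lambda>k. real q * (1 / pi) * inverse (real k ^ 2))"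
        by (intro summable_mult inverse_power_summable) auto
      fix k :: nat assume k: "k \<ge> 1"
      have "norm (\<Sum>a=1..q. cnj (chi (int a)) * pole_kernel (freq k a) t)
          \<le> real q * (4 * pi / ((2 * pi * real k)\<^sup>2 + t\<^sup>2))" by (rule norm_pole_sum_le[OF t])
      also have "\<dots> \<le> real q * (4 * pi / (2 * pi * real k)\<^sup>2)"
        using k by (intro mult_left_mono divide_left_mono) (auto simp: add_pos_nonneg)
      also have "\<dots> = real q * (1 / pi) * inverse (real k ^ 2)"
        using k by (simp add: power2_eq_square field_simps)
      finally show "norm (norm (\<Sum>a=1..q. cnj (chi (int a)) * pole_kernel (freq k a) t))
          \<le> real q * (1 / pi) * inverse (real k ^ 2)" by simp
    qed
  qed
  show "summable (\<lambda>k. real q * (4 * pi) * ((2 * pi * real k) powr (s - 2) * (pi / (2 * sin (pi * s / 2)))))"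
    using s by (intro summable_mult summable_mult2) (simp add: powr_mult summable_real_powr_iff)
  fix k :: nat assume k: "k \<ge> 1"
  have "has_bochner_integral (lebesgue_on {0<..})
      (\<lambda>t. real q * (4 * pi) * (t powr (s - 1) / ((2 * pi * real k)\<^sup>2 + t\<^sup>2)))
      (real q * (4 * pi) * ((2 * pi * real k) powr (s - 2) * (pi / (2 * sin (pi * s / 2)))))"
    using s k by (intro has_bochner_integral_mult_right Mellin_quadratic) auto
  then show "(\<integral>t. norm (of_real (t powr (s - 1)) *
      (\<Sum>a=1..q. cnj (chi (int a)) * pole_kernel (freq k a) t)) \<partial>lebesgue_on {0<..})
      \<le> real q * (4 * pi) * ((2 * pi * real k) powr (s - 2) * (pi / (2 * sin (pi * s / 2))))"
  proof (rule integral_norm_le[OF pole_sum_Mellin[OF s]])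
    fix t assume "t \<in> space (lebesgue_on {0::real<..})"
    then have t: "t > 0" by simp
    have "norm (of_real (t powr (s - 1)) * (\<Sum>a=1..q. cnj (chi (int a)) * pole_kernel (freq k a) t))
        \<le> t powr (s - 1) * (real q * (4 * pi / ((2 * pi * real k)\<^sup>2 + t\<^sup>2)))"
      unfolding norm_mult using norm_pole_sum_le[OF t] by (intro mult_mono) auto
    then show "norm (of_real (t powr (s - 1)) * (\<Sum>a=1..q. cnj (chi (int a)) * pole_kernel (freq k a) t))
        \<le> real q * (4 * pi) * (t powr (s - 1) / ((2 * pi * real k)\<^sup>2 + t\<^sup>2))" by (simp add: mult_ac)
  qed
qed

text \<open>Both sides are the Mellin transform of \<open>gauss 1 * theta t\<close>, evaluated
  through its two expansions.\<close>

lemma functional_equation_real: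
  assumes s: "0 < s" "s < 1"
  shows "gauss 1 * (of_real (Gamma s) * reg_L q chi (of_real s)) =
    \<i> ^ \<kappa> * of_real ((2 * pi / real q) powr (s - 1) * (pi / sin (pi * (s + 1 - real \<kappa>) / 2))) *
        reg_L q (\<lambda>a. cnj (chi a)) (1 - of_real s)"
proof -
  have "gauss 1 * (of_real (Gamma s) * reg_L q chi (of_real s)) =
      gauss 1 * (\<integral>t. of_real (t powr (s - 1)) * theta t \<partial>lebesgue_on {0<..})"
    using sums_unique2[OF theta_Mellin_left[OF s(1)] sums_mult[OF reg_L_sums]] s by simp
  also have "\<dots> = (\<integral>t. of_real (t powr (s - 1)) * (gauss 1 * theta t) \<partial>lebesgue_on {0<..})"
    by (simp add: mult.left_commute)
  also have "\<dots> = \<i> ^ \<kappa> * of_real ((2 * pi / real q) powr (s - 1) * (pi / sin (pi * (s + 1 - real \<kappa>) / 2))) *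
        reg_L q (\<lambda>a. cnj (chi a)) (1 - of_real s)"
    using s by (intro sums_unique2[OF theta_Mellin_right[OF s] sums_mult[OF dual.reg_L_sums]]) simp
  finally show ?thesis .
qed

end


section \<open>Continuation to the left half plane\<close>

lemma holomorphic_reflect:
  assumes "g holomorphic_on {s. Re s > 0}"
  shows "(\<lambda>s. g (1 - s)) holomorphic_on {s. Re s < 1}"
proof -
  have "(\<lambda>s. 1 - s) holomorphic_on {s. Re s < 1}" by (intro holomorphic_intros)
  moreover have "(\<lambda>s. 1 - s) ` {s. Re s < 1} \<subseteq> {s. Re s > 0}" by auto
  ultimately show ?thesis using holomorphic_on_compose_gen[OF _ assms] by (simp add: o_def)
qed

lemma one_minus_nonpos_Ints: "Re s < 1 \<Longrightarrow> 1 - s \<notin> \<int>\<^sub>\<le>\<^sub>0"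
  by (auto elim!: nonpos_Ints_cases simp: complex_eq_iff)

context char_parity
begin

abbreviation dual_L :: "complex \<Rightarrow> complex" where
  "dual_L \<equiv> reg_L q (\<lambda>a. cnj (chi a))"

text \<open>The factor A of the overview. For \<open>Re s \<le> -1\<close> it has no zeros, so there
  \<open>fe_sin\<close> carries all zeros of the L-function.\<close>

definition fe_smooth :: "complex \<Rightarrow> complex" where
  "fe_smooth s = 2 * \<i> ^ \<kappa> / gauss 1 * Gamma (1 - s) *
     exp ((s - 1) * of_real (ln (2 * pi / real q))) * dual_L (1 - s)"

definition fe_sin :: "complex \<Rightarrow> complex" where
  "fe_sin s = sin (of_real pi * (s + of_nat \<kappa>) / 2)"

definition left_L :: "complex \<Rightarrow> complex" where
  "left_L s = fe_smooth s * fe_sin s"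

lemma fe_smooth_holomorphic: "fe_smooth holomorphic_on {s. Re s < 1}"
  unfolding fe_smooth_def
  by (intro holomorphic_intros holomorphic_reflect dual.reg_L_holomorphic)
    (auto simp: one_minus_nonpos_Ints)

lemma left_L_holomorphic: "left_L holomorphic_on {s. Re s < 1}"
  unfolding left_L_def fe_sin_def by (intro holomorphic_intros fe_smooth_holomorphic) auto

text \<open>Passage to the unsymmetric form. For either parity \<open>sin (pi * s)\<close> is twice
  the product of the sines at \<open>pi * (s + \<kappa>) / 2\<close> and
  \<open>pi * (s + 1 - \<kappa>) / 2\<close>; together with the reflection formula this trades
  \<open>Gamma s\<close> and a sine in the denominator for \<open>Gamma (1 - s)\<close> and a sine
  in the numerator.\<close>

lemma reg_L_eq_left_L_real:
  assumes s: "0 < s" "s < 1"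
  shows "reg_L q chi (of_real s) = left_L (of_real s)"
proof -
  let ?S = "sin (pi * (s + 1 - real \<kappa>) / 2)" and ?S' = "sin (pi * (s + real \<kappa>) / 2)"
  have G: "Gamma s > 0" using s by simp
  have "complex_of_real (Gamma s * Gamma (1 - s)) = complex_of_real (pi / sin (pi * s))"
    using Gamma_reflection_complex[of "complex_of_real s"] Gamma_complex_of_real[of "1 - s"]
    by (simp add: Gamma_complex_of_real flip: sin_of_real of_real_mult)
  then have refl: "Gamma s * Gamma (1 - s) = pi / sin (pi * s)" by (simp only: of_real_eq_iff)
  have "pi * s < pi" using s by simp
  then have sin0: "sin (pi * s) > 0" using s by (intro sin_gt_zero) auto
  have plus: "sin (pi * (s + 1) / 2) = cos (pi * s / 2)"
  proof -
    have "pi * (s + 1) / 2 = pi * s / 2 + pi / 2" by (simp add: field_simps)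
    then show ?thesis by (simp only: sin_add) simp
  qed
  have "sin (pi * s) = 2 * ?S' * ?S"
  proof -
    have "sin (pi * s) = 2 * sin (pi * s / 2) * cos (pi * s / 2)"
      using sin_double[of "pi * s / 2"] by simp
    then show ?thesis using parity_cases plus by auto
  qed
  then have nz: "?S \<noteq> 0" "?S' \<noteq> 0" and refl': "Gamma s * Gamma (1 - s) = pi / (2 * ?S' * ?S)"
    using refl sin0 by auto
  have "Gamma s * (2 * Gamma (1 - s) * ?S') = (Gamma s * Gamma (1 - s)) * (2 * ?S')" by simp
  also have "\<dots> = pi / ?S" unfolding refl' using nz by simp
  finally have "pi / ?S = Gamma s * (2 * Gamma (1 - s) * ?S')" by (rule sym)
  then have "gauss 1 * (of_real (Gamma s) * reg_L q chi (of_real s)) =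
      \<i> ^ \<kappa> * of_real ((2 * pi / real q) powr (s - 1) * (Gamma s * (2 * Gamma (1 - s) * ?S'))) *
        dual_L (1 - of_real s)"
    using functional_equation_real[OF s] by simp
  also have "\<dots> = of_real (Gamma s) * (\<i> ^ \<kappa> * of_real ((2 * pi / real q) powr (s - 1) * (2 * Gamma (1 - s) * ?S')) *
        dual_L (1 - of_real s))" by simp
  finally have "of_real (Gamma s) * (gauss 1 * reg_L q chi (of_real s)) = \<dots>" by (simp only: mult.left_commute)
  then have eq: "gauss 1 * reg_L q chi (of_real s) =
      \<i> ^ \<kappa> * of_real ((2 * pi / real q) powr (s - 1) * (2 * Gamma (1 - s) * ?S')) * dual_L (1 - of_real s)"
    using G by (subst (asm) mult_left_cancel) auto
  have "complex_of_real ((2 * pi / real q) powr (s - 1)) = exp ((of_real s - 1) * of_real (ln (2 * pi / real q)))"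
    using q_pos by (simp add: powr_def flip: exp_of_real)
  moreover have "complex_of_real (Gamma (1 - s)) = Gamma (1 - of_real s)"
    using Gamma_complex_of_real[of "1 - s"] by simp
  moreover have "complex_of_real ?S' = fe_sin (of_real s)"
    by (simp add: fe_sin_def flip: sin_of_real)
  ultimately have "gauss 1 * reg_L q chi (of_real s) = gauss 1 * left_L (of_real s)"
    using gauss_1_nonzero unfolding eq left_L_def fe_smooth_def of_real_mult by simp
  then show ?thesis using gauss_1_nonzero by simp
qed

lemma reg_L_eq_left_L:
  assumes "0 < Re s" "Re s < 1"
  shows "reg_L q chi s = left_L s"
proof -
  let ?S = "{s. 0 < Re s} \<inter> {s. Re s < 1}"
  have "reg_L q chi s - left_L s = 0"
  proof (rule analytic_continuation[where f = "\<lambda>s. reg_L q chi s - left_L s" and S = ?S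
        and U = "of_real ` {0<..<1}" and \<xi> = "1 / 2"])
    show "(\<lambda>s. reg_L q chi s - left_L s) holomorphic_on ?S"
      using reg_L_holomorphic left_L_holomorphic
      by (intro holomorphic_on_diff) (auto intro: holomorphic_on_subset)
    show "open ?S" by (intro open_Int open_halfspace_Re_gt open_halfspace_Re_lt)
    show "connected ?S"
      by (intro convex_connected convex_Int convex_halfspace_Re_gt convex_halfspace_Re_lt)
    show "(1 / 2 :: complex) islimpt of_real ` {0<..<1}"
      unfolding islimpt_approachable
    proof (intro allI impI)
      fix e :: real assume e: "e > 0"
      define x where "x = 1 / 2 + min (e / 2) (1 / 4)"
      have "dist (complex_of_real x) (complex_of_real (1 / 2)) < e"
        using e unfolding dist_of_real by (simp add: dist_real_def x_def)
      moreover have "complex_of_real x \<noteq> complex_of_real (1 / 2)"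
        using e unfolding of_real_eq_iff by (simp add: x_def min_def)
      moreover have "complex_of_real x \<in> of_real ` {0<..<1}"
        using e by (intro imageI) (auto simp: x_def min_def)
      ultimately show "\<exists>x'\<in>of_real ` {0<..<1}. x' \<noteq> 1 / 2 \<and> dist x' (1 / 2 :: complex) < e"
        by (intro bexI[of _ "complex_of_real x"]) auto
    qed
  qed (use assms reg_L_eq_left_L_real in auto)
  then show ?thesis by simp
qed

text \<open>\<open>reg_L\<close> and \<open>left_L\<close> agree on the critical strip and their
  half planes cover the plane, so they glue to an entire function; uniqueness of the continuation
  identifies it with \<open>dirichlet_L chi\<close>.\<close>

lemma dirichlet_L_eq_left_L:
  assumes "Re s < 1"
  shows "dirichlet_L chi s = left_L s"
proof -
  define F where "F s = (if Re s > 0 then reg_L q chi s else left_L s)" for s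
  have F_left: "F s = left_L s" if "Re s < 1" for s
    using that reg_L_eq_left_L by (simp add: F_def)
  have F_right: "F s = reg_L q chi s" if "Re s > 1" for s
    using that by (simp add: F_def)
  have "F holomorphic_on {s. Re s > 0} \<union> {s. Re s < 1}"
  proof (rule holomorphic_on_Un)
    show "F holomorphic_on {s. Re s > 0}"
      by (rule holomorphic_transform[OF reg_L_holomorphic]) (simp add: F_def)
    show "F holomorphic_on {s. Re s < 1}"
      by (rule holomorphic_transform[OF left_L_holomorphic]) (simp add: F_left)
  qed (rule open_halfspace_Re_gt open_halfspace_Re_lt)+
  also have "{s. Re s > 0} \<union> {s. Re s < 1} = UNIV" by auto
  finally have "is_dirichlet_L chi F"
    using Dirichlet_series_sums F_right by (simp add: is_dirichlet_L_def)
  then show ?thesis using F_left[OF assms] by (simp add: dirichlet_L_eqI)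
qed

text \<open>The quantity R of the overview, minus the logarithmic derivative of
  \<open>fe_smooth\<close>.\<close>

definition fe_log_deriv :: "complex \<Rightarrow> complex" where
  "fe_log_deriv s = Digamma (1 - s) - of_real (ln (2 * pi / real q)) +
     deriv dual_L (1 - s) / dual_L (1 - s)"

lemma dual_L_nonzero: "Re s \<ge> 2 \<Longrightarrow> dual_L s \<noteq> 0"
  using dual.norm_reg_L_ge[of s] by auto

lemma fe_smooth_has_derivative:
  assumes s: "Re s \<le> -1"
  shows "(fe_smooth has_field_derivative - fe_smooth s * fe_log_deriv s) (at s)"
proof -
  have hol: "dual_L holomorphic_on {s. Re s > 0}" by (rule dual.reg_L_holomorphic)
  have "open {s. Re s > 0}" by (rule open_halfspace_Re_gt)
  then have D: "(dual_L has_field_derivative deriv dual_L (1 - s)) (at (1 - s))"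
    using hol s by (intro holomorphic_derivI) auto
  have "((\<lambda>s. dual_L (1 - s)) has_field_derivative deriv dual_L (1 - s) * (- 1)) (at s)"
    by (rule DERIV_chain2[where g = "\<lambda>s. 1 - s", OF D]) (auto intro!: derivative_eq_intros)
  then have D': "((\<lambda>s. dual_L (1 - s)) has_field_derivative - deriv dual_L (1 - s)) (at s)"
    by simp
  have G: "((\<lambda>s. Gamma (1 - s)) has_field_derivative - (Gamma (1 - s) * Digamma (1 - s))) (at s)"
    using one_minus_nonpos_Ints[of s] s by (auto intro!: derivative_eq_intros)
  have nz: "dual_L (1 - s) \<noteq> 0" using s by (intro dual_L_nonzero) simp
  let ?c = "complex_of_real (ln (2 * pi / real q))"
  have E: "((\<lambda>s. exp ((s - 1) * ?c)) has_field_derivative exp ((s - 1) * ?c) * ?c) (at s)"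
    by (auto intro!: derivative_eq_intros)
  show ?thesis
    unfolding fe_smooth_def[abs_def]
    by (rule DERIV_cong[OF DERIV_mult[OF DERIV_mult[OF DERIV_cmult[OF G] E] D']])
      (simp add: fe_log_deriv_def nz add_divide_distrib diff_divide_distrib algebra_simps)
qed

lemma fe_smooth_nonzero:
  assumes s: "Re s \<le> -1"
  shows "fe_smooth s \<noteq> 0"
  using gauss_1_nonzero dual_L_nonzero[of "1 - s"] one_minus_nonpos_Ints[of s] s
  by (simp add: fe_smooth_def Gamma_eq_zero_iff)

text \<open>The product rule leaves the nonvanishing factor \<open>fe_smooth s\<close>, which
  cancels. The equation is kept free of denominators; the tangent enters only once the cosine is
  known to be nonzero.\<close>

lemma deriv_dirichlet_L_eq_0_iff:
  assumes s: "Re s \<le> -1"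
  shows "deriv (dirichlet_L chi) s = 0 \<longleftrightarrow>
    of_real pi / 2 * cos (of_real pi * (s + of_nat \<kappa>) / 2) = fe_log_deriv s * sin (of_real pi * (s + of_nat \<kappa>) / 2)"
proof -
  have "(fe_sin has_field_derivative of_real pi / 2 * cos (of_real pi * (s + of_nat \<kappa>) / 2)) (at s)"
    unfolding fe_sin_def[abs_def] by (auto intro!: derivative_eq_intros)
  from DERIV_mult[OF fe_smooth_has_derivative[OF s] this]
  have "(left_L has_field_derivative fe_smooth s *
      (of_real pi / 2 * cos (of_real pi * (s + of_nat \<kappa>) / 2) - fe_log_deriv s * fe_sin s)) (at s)"
    unfolding left_L_def[abs_def] by (rule DERIV_cong) (simp add: algebra_simps)
  then have "(dirichlet_L chi has_field_derivative fe_smooth s *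
      (of_real pi / 2 * cos (of_real pi * (s + of_nat \<kappa>) / 2) - fe_log_deriv s * fe_sin s)) (at s)"
  proof (rule has_field_derivative_transform_within_open)
    show "open {s. Re s < 1}" by (rule open_halfspace_Re_lt)
  qed (use s dirichlet_L_eq_left_L in auto)
  then show ?thesis
    using fe_smooth_nonzero[OF s] by (simp add: DERIV_imp_deriv fe_sin_def)
qed

end

section \<open>The logarithmic derivative\<close>

text \<open>Termwise comparison of the defining series: the real part of the inverse of
  \<open>u + n\<close> is at most the inverse of its modulus, hence at most the inverse of
  \<open>x + n\<close>. No bound on \<open>Im u\<close> enters.\<close>

lemma Re_Digamma_ge:
  fixes u :: complex
  assumes x: "0 < x" "x \<le> Re u"
  shows "Digamma x \<le> Re (Digamma u)"
proof -
  have u0: "u \<noteq> 0" using x by auto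
  have "(\<lambda>n. inverse (of_nat (Suc n)) - inverse (u + of_nat n)) sums (Digamma u + euler_mascheroni)"
    using summable_sums[OF summable_Digamma[OF u0]] by (simp add: Digamma_def)
  then have sums_u: "(\<lambda>n. Re (inverse (of_nat (Suc n)) - inverse (u + of_nat n))) sums
      Re (Digamma u + euler_mascheroni)" by (rule sums_Re)
  have sums_x: "(\<lambda>n. inverse (real (Suc n)) - inverse (x + real n)) sums (Digamma x + euler_mascheroni)"
    using summable_sums[OF summable_Digamma[of x]] x by (simp add: Digamma_def)
  have "Digamma x + euler_mascheroni \<le> Re (Digamma u + euler_mascheroni)"
  proof (rule sums_le[OF _ sums_x sums_u])
    fix n
    have pos: "Re (u + of_nat n) > 0" using x by simp
    have "Re (inverse (u + of_nat n)) \<le> norm (inverse (u + of_nat n))" by (rule complex_Re_le_cmod)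
    also have "\<dots> = inverse (norm (u + of_nat n))" by (rule norm_inverse)
    also have "\<dots> \<le> inverse (Re (u + of_nat n))"
      using pos by (intro le_imp_inverse_le complex_Re_le_cmod)
    also have "\<dots> \<le> inverse (x + real n)" using x by (intro le_imp_inverse_le) auto
    finally have le: "Re (inverse (u + of_nat n)) \<le> inverse (x + real n)" .
    have "Re (inverse (of_nat (Suc n))) = inverse (real (Suc n))"
      by (metis Re_complex_of_real of_real_inverse of_real_of_nat_eq)
    then show "inverse (real (Suc n)) - inverse (x + real n)
        \<le> Re (inverse (of_nat (Suc n)) - inverse (u + of_nat n))"
      using le by simp
  qed
  moreover have "Re (euler_mascheroni :: complex) = euler_mascheroni"
    using of_real_euler_mascheroni[where 'a = complex] by (metis Re_complex_of_real)
  ultimately show ?thesis by simp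
qed

definition log_deriv_const :: real where
  "log_deriv_const = euler_mascheroni + ln (2 * pi) + 8 * zeta_bound"

context char_parity
begin

lemma Re_fe_log_deriv_ge:
  assumes j: "j \<ge> 1" and s: "Re s \<le> 1 - 2 * real j"
  shows "Re (fe_log_deriv s) \<ge> ln (real (j * q)) - log_deriv_const"
proof -
  \<comment> \<open>Here \<open>1 - s\<close> has real part at least \<open>2 * j\<close>, and
    Digamma at \<open>2 * j\<close> is the harmonic number of index \<open>2 * j - 1\<close> minus
    Euler's constant.\<close>
  have "ln (real (2 * j - 1) + 1) - euler_mascheroni \<le> harm (2 * j - 1) - euler_mascheroni"
    using ln_le_harm by simp
  also have "\<dots> = Digamma (real (Suc (2 * j - 1)))" by (rule Digamma_of_nat[symmetric])
  also have "\<dots> \<le> Re (Digamma (1 - s))"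
    using j s by (intro Re_Digamma_ge) (auto simp: of_nat_diff)
  also have "real (2 * j - 1) + 1 = 2 * real j" using j by (simp add: of_nat_diff)
  finally have D: "ln (2 * real j) - euler_mascheroni \<le> Re (Digamma (1 - s))" .
  have "ln (real j) \<le> ln (2 * real j)" using j by simp
  moreover have "ln (real (j * q)) = ln (real j) + ln (real q)"
    using j q_pos by (simp add: ln_mult)
  moreover have "ln (2 * pi / real q) = ln (2 * pi) - ln (real q)"
    using q_pos by (simp add: ln_div)
  moreover have "norm (deriv dual_L (1 - s) / dual_L (1 - s)) \<le> 8 * zeta_bound"
    using j s by (intro dual.norm_logderiv_reg_L_le) auto
  then have "Re (deriv dual_L (1 - s) / dual_L (1 - s)) \<ge> - (8 * zeta_bound)"
    using abs_Re_le_cmod[of "deriv dual_L (1 - s) / dual_L (1 - s)"] by linarith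
  ultimately show ?thesis using D by (simp add: fe_log_deriv_def log_deriv_const_def)
qed

lemma fe_log_deriv_holomorphic: "fe_log_deriv holomorphic_on {s. Re s < -1}"
proof -
  have sub: "(\<lambda>s. g (1 - s)) holomorphic_on {s. Re s < -1}" if "g holomorphic_on {s. Re s > 0}" for g
    using holomorphic_reflect[OF that] by (rule holomorphic_on_subset) auto
  have "deriv dual_L holomorphic_on {s. Re s > 0}"
    by (intro holomorphic_deriv dual.reg_L_holomorphic open_halfspace_Re_gt)
  then have "(\<lambda>s. deriv dual_L (1 - s) / dual_L (1 - s)) holomorphic_on {s. Re s < -1}"
    using dual_L_nonzero by (intro holomorphic_on_divide sub dual.reg_L_holomorphic) auto
  moreover have "(\<lambda>s. Digamma (1 - s)) holomorphic_on {s. Re s < -1}"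
    by (intro sub holomorphic_on_Polygamma) (auto elim!: nonpos_Ints_cases)
  ultimately show ?thesis
    unfolding fe_log_deriv_def by (intro holomorphic_on_add holomorphic_on_diff holomorphic_on_const)
qed

end


section \<open>Zeros of the derivative\<close>

lemma Arctan_Lipschitz:
  assumes "norm z \<le> 1 / 2" "norm w \<le> 1 / 2"
  shows "norm (Arctan z - Arctan w) \<le> 2 * norm (z - w)"
proof (rule field_differentiable_bound[where S = "cball 0 (1 / 2)"])
  fix x :: complex assume "x \<in> cball 0 (1 / 2)"
  then have x: "norm x \<le> 1 / 2" by simp
  then have "\<bar>Im x\<bar> < 1" using abs_Im_le_cmod[of x] by linarith
  then show "(Arctan has_field_derivative inverse (1 + x\<^sup>2)) (at x within cball 0 (1 / 2))"
    by (intro has_field_derivative_at_within[OF has_field_derivative_Arctan])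
  have "norm (x\<^sup>2) \<le> (1 / 2)\<^sup>2" unfolding norm_power using x by (intro power_mono) auto
  then have "norm (1 + x\<^sup>2) \<ge> 1 / 2"
    using norm_triangle_ineq2[of 1 "- x\<^sup>2"] by (simp add: power2_eq_square)
  then have "inverse (norm (1 + x\<^sup>2)) \<le> inverse (1 / 2)" by (intro le_imp_inverse_le) auto
  then show "norm (inverse (1 + x\<^sup>2)) \<le> 2" by (simp add: norm_inverse)
qed (use assms in auto)

lemma norm_Arctan_le:
  assumes "norm z \<le> 1 / 2" shows "norm (Arctan z) \<le> 2 * norm z"
  using Arctan_Lipschitz[OF assms, of 0] by simp

text \<open>On the strip the equation is equivalent to \<open>T w = w\<close>. Since
  \<open>T\<close> sends the entire strip into the disc of radius \<open>2 * \<epsilon>\<close>,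
  which is at most 1/5, every solution lies in the disc where the Banach fixed point theorem
  applies; uniqueness there is uniqueness in the strip.\<close>

lemma tan_fixed_point:
  fixes h :: "complex \<Rightarrow> complex"
  assumes hol: "h holomorphic_on {w. \<bar>Re w\<bar> < 1}"
    and bound: "\<And>w. \<bar>Re w\<bar> < 1 \<Longrightarrow> norm (h w) \<le> \<epsilon>" and \<epsilon>: "\<epsilon> \<le> 1 / 10"
  shows "\<exists>w. \<bar>Re w\<bar> < 1 \<and> tan (of_real pi * w / 2) = h w \<and> norm w \<le> 2 * \<epsilon> \<and>
           (\<forall>w'. \<bar>Re w'\<bar> < 1 \<and> tan (of_real pi * w' / 2) = h w' \<longrightarrow> w' = w)"
proof -
  define T where "T w = 2 / of_real pi * Arctan (h w)" for w
  let ?B = "cball (0::complex) (1 / 2)"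
  have strip: "\<bar>Re w\<bar> < 1" if "norm w < 1" for w using that abs_Re_le_cmod[of w] by linarith
  have norm_pi: "norm (2 / complex_of_real pi * z) \<le> norm z" for z
  proof -
    have "norm (2 / complex_of_real pi * z) = 2 / pi * norm z" by (simp add: norm_mult norm_divide)
    also have "\<dots> \<le> 1 * norm z" using pi_gt3 by (intro mult_right_mono) auto
    finally show ?thesis by simp
  qed
  have T_norm: "norm (T w) \<le> 2 * \<epsilon>" if "\<bar>Re w\<bar> < 1" for w
  proof -
    have "norm (T w) \<le> norm (Arctan (h w))" unfolding T_def by (rule norm_pi)
    also have "\<dots> \<le> 2 * norm (h w)" using bound[OF that] \<epsilon> by (intro norm_Arctan_le) simp
    also have "\<dots> \<le> 2 * \<epsilon>" using bound[OF that] by simp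
    finally show ?thesis .
  qed
  have iff: "tan (of_real pi * w / 2) = h w \<longleftrightarrow> T w = w" if w: "\<bar>Re w\<bar> < 1" for w
  proof
    assume "tan (of_real pi * w / 2) = h w"
    moreover have "Arctan (tan (of_real pi * w / 2)) = of_real pi * w / 2"
      using w by (intro Arctan_tan) (simp add: abs_mult)
    ultimately have A: "Arctan (h w) = of_real pi * w / 2" by simp
    show "T w = w" unfolding T_def A by simp
  next
    assume "T w = w"
    then have "of_real pi * w / 2 = Arctan (h w)" by (auto simp: T_def field_simps)
    \<comment> \<open>The values with square -1 are the two points where tan does not undo
      Arctan.\<close>
    moreover have "(h w)\<^sup>2 \<noteq> -1"
    proof
      assume "(h w)\<^sup>2 = -1"
      then have "norm (h w) ^ 2 = 1" by (metis norm_minus_cancel norm_one norm_power)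
      then have "norm (h w) = 1" using norm_ge_zero[of "h w"] by (auto simp: power2_eq_1_iff)
      then show False using bound[OF w] \<epsilon> by simp
    qed
    ultimately show "tan (of_real pi * w / 2) = h w" by simp
  qed
  have deriv_h: "norm (deriv h x) \<le> 4 * \<epsilon>" if x: "x \<in> ?B" for x
  proof -
    have sub: "\<bar>Re y\<bar> < 1" if "y \<in> cball x (1 / 4)" for y
      using that x norm_triangle_ineq[of x "y - x"]
      by (intro strip) (simp add: dist_norm norm_minus_commute)
    then have hol': "h holomorphic_on cball x (1 / 4)"
      by (intro holomorphic_on_subset[OF hol]) auto
    have "norm ((deriv ^^ 1) h x) \<le> fact 1 * \<epsilon> / (1 / 4) ^ 1"
    proof (rule Cauchy_inequality)
      show "h holomorphic_on ball x (1 / 4)"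
        using hol' by (meson ball_subset_cball holomorphic_on_subset)
      show "continuous_on (cball x (1 / 4)) h"
        using hol' by (rule holomorphic_on_imp_continuous_on)
      show "norm (h y) \<le> \<epsilon>" if "norm (x - y) = 1 / 4" for y
        using that by (intro bound sub) (simp add: dist_norm)
    qed simp
    then show ?thesis by simp
  qed
  have op: "open {w::complex. \<bar>Re w\<bar> < 1}"
    by (intro open_Collect_less continuous_intros)
  have "\<exists>!w\<in>?B. T w = w"
  \<comment> \<open>Cauchy's inequality on discs of radius 1/4 bounds the derivative of
    \<open>h\<close> by 4/10, Arctan at most doubles this, and the factor 2/pi is estimated by
    1.\<close>
  proof (rule Banach_fix[where c = "8 / 10"])
    show "T ` ?B \<subseteq> ?B"
    proof clarify
      fix w :: complex assume "w \<in> ?B"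
      then have "norm (T w) \<le> 2 * \<epsilon>" by (intro T_norm strip) simp
      then show "T w \<in> ?B" using \<epsilon> by simp
    qed
    fix x y assume xy: "x \<in> ?B" "y \<in> ?B"
    have "norm (h x - h y) \<le> 4 * \<epsilon> * norm (x - y)"
    proof (rule field_differentiable_bound[where S = ?B and f' = "deriv h"])
      fix z assume z: "z \<in> ?B"
      then have "\<bar>Re z\<bar> < 1" by (intro strip) simp
      then show "(h has_field_derivative deriv h z) (at z within ?B)"
        by (intro has_field_derivative_at_within[OF holomorphic_derivI[OF hol op]]) simp
      show "norm (deriv h z) \<le> 4 * \<epsilon>" by (rule deriv_h[OF z])
    qed (use xy in auto)
    also have "\<dots> \<le> 4 * (1 / 10) * norm (x - y)" using \<epsilon> by (intro mult_right_mono) auto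
    finally have h: "norm (h x - h y) \<le> 4 / 10 * norm (x - y)" by simp
    have "T x - T y = 2 / of_real pi * (Arctan (h x) - Arctan (h y))"
      by (simp add: T_def right_diff_distrib)
    then have "norm (T x - T y) \<le> norm (Arctan (h x) - Arctan (h y))" by (simp only: norm_pi)
    also have "\<dots> \<le> 2 * norm (h x - h y)"
    proof (rule Arctan_Lipschitz)
      have "\<bar>Re x\<bar> < 1" "\<bar>Re y\<bar> < 1" using xy by (auto intro!: strip)
      then show "norm (h x) \<le> 1 / 2" "norm (h y) \<le> 1 / 2" using bound[of x] bound[of y] \<epsilon> by auto
    qed
    finally show "dist (T x) (T y) \<le> 8 / 10 * dist x y" using h by (simp add: dist_norm)
  qed (auto simp: complete_eq_closed)
  then obtain w where w: "w \<in> ?B" "T w = w" and uniq: "\<And>w'. w' \<in> ?B \<Longrightarrow> T w' = w' \<Longrightarrow> w' = w"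
    by blast
  have ws: "\<bar>Re w\<bar> < 1" using w by (intro strip) simp
  have "w' = w" if w': "\<bar>Re w'\<bar> < 1" "tan (of_real pi * w' / 2) = h w'" for w'
  proof (rule uniq)
    show fixed: "T w' = w'" using iff w' by blast
    show "w' \<in> ?B" using T_norm[OF w'(1)] \<epsilon> unfolding fixed by simp
  qed
  moreover have "norm w \<le> 2 * \<epsilon>" using T_norm[OF ws] w(2) by simp
  moreover have "tan (of_real pi * w / 2) = h w" using iff[OF ws] w(2) by blast
  ultimately show ?thesis using ws by blast
qed

lemma cos_half_strip_nonzero:
  assumes "\<bar>Re w\<bar> < 1" shows "cos (of_real pi * w / 2) \<noteq> 0"
proof
  assume "cos (of_real pi * w / 2) = 0"
  then obtain n :: int where "of_real pi * w / 2 = of_real (n * pi) + of_real pi / 2"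
    by (auto simp: cos_eq_0)
  then have "of_real pi * w = of_real pi * of_int (2 * n + 1)" by (simp add: field_simps)
  then have "w = of_int (2 * n + 1)" by (subst (asm) mult_left_cancel) auto
  then have "\<bar>real_of_int (2 * n + 1)\<bar> < 1" using assms by (simp only: complex_Re_of_int)
  then have "\<bar>2 * n + 1\<bar> < 1" by linarith
  then show False by presburger
qed

lemma sin_cos_shift:
  fixes w :: complex
  shows "sin (of_real pi * (w - 2 * of_nat j) / 2) = (-1) ^ j * sin (of_real pi * w / 2)"
    and "cos (of_real pi * (w - 2 * of_nat j) / 2) = (-1) ^ j * cos (of_real pi * w / 2)"
proof -
  have e: "of_real pi * (w - 2 * of_nat j) / 2 = of_real pi * w / 2 - of_real (real j * pi)"
    by (simp add: field_simps)
  show "sin (of_real pi * (w - 2 * of_nat j) / 2) = (-1) ^ j * sin (of_real pi * w / 2)"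
    unfolding e by (simp only: sin_diff sin_of_real cos_of_real cos_npi sin_npi) simp
  show "cos (of_real pi * (w - 2 * of_nat j) / 2) = (-1) ^ j * cos (of_real pi * w / 2)"
    unfolding e by (simp only: cos_diff sin_of_real cos_of_real cos_npi sin_npi) simp
qed

context char_parity
begin

lemma L_deriv_zero_estimate:
  assumes j: "j \<ge> 1" and large: "ln (real (j * q)) \<ge> max 32 (2 * log_deriv_const)"
  shows "norm (L_deriv_zero chi \<kappa> j - (- 2 * of_nat j - of_nat \<kappa>)) \<le> 2 * pi / ln (real (j * q))"
proof -
  define l where "l = ln (real (j * q))"
  \<comment> \<open>The bound 32 makes \<open>pi / l\<close> at most 3.2/32 = 1/10, as the fixed
    point argument requires; the other one lets \<open>l / 2\<close> absorb
    \<open>log_deriv_const\<close>.\<close>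
  have l: "l \<ge> 32" "l \<ge> 2 * log_deriv_const" using large by (simp_all add: l_def)
  define pt where "pt w = w - 2 * of_nat j - of_nat \<kappa>" for w :: complex
  define R where "R w = fe_log_deriv (pt w)" for w
  define h where "h w = of_real pi / 2 / R w" for w
  have Re_pt: "Re (pt w) < 1 - 2 * real j" if "\<bar>Re w\<bar> < 1" for w
    using that by (simp add: pt_def)
  have R_ge: "norm (R w) \<ge> l / 2" if "\<bar>Re w\<bar> < 1" for w
  proof -
    have "Re (R w) \<ge> l - log_deriv_const"
      using Re_fe_log_deriv_ge[OF j, of "pt w"] Re_pt[OF that] by (simp add: R_def l_def)
    then show ?thesis using l complex_Re_le_cmod[of "R w"] by linarith
  qed
  have R0: "R w \<noteq> 0" if "\<bar>Re w\<bar> < 1" for w using R_ge[OF that] l by auto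
  have h_hol: "h holomorphic_on {w. \<bar>Re w\<bar> < 1}"
  proof -
    have "pt holomorphic_on {w. \<bar>Re w\<bar> < 1}" unfolding pt_def by (intro holomorphic_intros)
    moreover have "pt ` {w. \<bar>Re w\<bar> < 1} \<subseteq> {s. Re s < -1}"
      using Re_pt j by fastforce
    ultimately have "R holomorphic_on {w. \<bar>Re w\<bar> < 1}"
      using holomorphic_on_compose_gen[OF _ fe_log_deriv_holomorphic] by (simp add: R_def[abs_def] o_def)
    then show ?thesis unfolding h_def using R0 by (intro holomorphic_intros) auto
  qed
  have h_bound: "norm (h w) \<le> pi / l" if "\<bar>Re w\<bar> < 1" for w
  proof -
    have "norm (h w) = (pi / 2) / norm (R w)" by (simp add: h_def norm_divide)
    also have "\<dots> \<le> (pi / 2) / (l / 2)" using R_ge[OF that] l by (intro divide_left_mono mult_pos_pos) auto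
    finally show ?thesis by simp
  qed
  have "pi / l \<le> 3.2 / 32" using l pi_approx by (intro frac_le) auto
  then have eps: "pi / l \<le> 1 / 10" by simp
  obtain w where w: "\<bar>Re w\<bar> < 1" "tan (of_real pi * w / 2) = h w" "norm w \<le> 2 * (pi / l)"
    and uniq: "\<And>w'. \<bar>Re w'\<bar> < 1 \<Longrightarrow> tan (of_real pi * w' / 2) = h w' \<Longrightarrow> w' = w"
    using tan_fixed_point[OF h_hol h_bound eps] by blast
  have zero_iff: "deriv (dirichlet_L chi) (pt w) = 0 \<longleftrightarrow> tan (of_real pi * w / 2) = h w"
    if w: "\<bar>Re w\<bar> < 1" for w
  proof -
    have e: "pt w + of_nat \<kappa> = w - 2 * of_nat j" by (simp add: pt_def)
    have "Re (pt w) \<le> -1" using Re_pt[OF w] j by simp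
    then have "deriv (dirichlet_L chi) (pt w) = 0 \<longleftrightarrow>
        of_real pi / 2 * cos (of_real pi * w / 2) = R w * sin (of_real pi * w / 2)"
      unfolding deriv_dirichlet_L_eq_0_iff[OF \<open>Re (pt w) \<le> -1\<close>] e sin_cos_shift R_def[symmetric]
      by (simp add: mult.assoc)
    also have "\<dots> \<longleftrightarrow> tan (of_real pi * w / 2) = h w"
      using R0[OF w] cos_half_strip_nonzero[OF w] by (auto simp: tan_def h_def field_simps)
    finally show ?thesis .
  qed
  have "L_deriv_zero chi \<kappa> j = pt w"
    unfolding L_deriv_zero_def
  proof (rule the_equality)
    show "- 2 * real j - real \<kappa> - 1 < Re (pt w) \<and> Re (pt w) < - 2 * real j - real \<kappa> + 1 \<and>
        deriv (dirichlet_L chi) (pt w) = 0"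
      using w zero_iff by (auto simp: pt_def)
    fix z assume z: "- 2 * real j - real \<kappa> - 1 < Re z \<and> Re z < - 2 * real j - real \<kappa> + 1 \<and>
        deriv (dirichlet_L chi) z = 0"
    define w' where "w' = z + 2 * of_nat j + of_nat \<kappa>"
    have zw: "z = pt w'" by (simp add: w'_def pt_def)
    have "\<bar>Re w'\<bar> < 1" using z by (auto simp: w'_def)
    then have "w' = w" using uniq zero_iff z zw by blast
    then show "z = pt w" by (simp add: zw)
  qed
  then have "L_deriv_zero chi \<kappa> j - (- 2 * of_nat j - of_nat \<kappa>) = w" by (simp add: pt_def)
  then show ?thesis using w(3) by (simp add: l_def)
qed

end

theorem theorem3:
  "\<exists>C::real. \<forall>(q::nat) (chi :: int \<Rightarrow> complex) (\<kappa>::nat) (j::nat).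
     q > 1 \<longrightarrow> primitive_dirichlet_character q chi \<longrightarrow>
     \<kappa> \<in> {0, 1} \<longrightarrow> chi (-1) = (-1) ^ \<kappa> \<longrightarrow> j \<ge> 1 \<longrightarrow>
     cmod (L_deriv_zero chi \<kappa> j - (- 2 * of_nat j - of_nat \<kappa>)) \<le> C / ln (real (j * q))"
proof -
  \<comment> \<open>Only finitely many \<open>(chi, \<kappa>, j)\<close> have \<open>ln (j * q) < K\<close>. For those any value of the definite
    description is admissible, so uniqueness of the zero is needed for large \<open>j * q\<close> only.\<close>
  define K where "K = max 32 (2 * log_deriv_const)"
  define N where "N = nat \<lceil>exp K\<rceil>"
  define err where "err = (\<lambda>(chi, \<kappa>, j). cmod (L_deriv_zero chi \<kappa> j - (- 2 * of_nat j - of_nat \<kappa>)))"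
  define E :: "((int \<Rightarrow> complex) \<times> nat \<times> nat) set"
    where "E = (\<Union>q\<in>{2..N}. {chi. dirichlet_character q chi}) \<times> {0, 1} \<times> {1..N}"
  have "finite E" unfolding E_def
    by (intro finite_cartesian_product finite_UN_I finite_dirichlet_characters) auto
  then have "bdd_above (err ` E)" by (intro bdd_above_finite finite_imageI)
  then obtain D where D: "\<And>x. x \<in> E \<Longrightarrow> err x \<le> D"
    by (auto simp: bdd_above_def)
  \<comment> \<open>On the exceptional set the error is at most \<open>D\<close> and
    \<open>ln (real (j * q)) < K\<close>, so \<open>D * K\<close> divided by the logarithm is still
    at least \<open>D\<close>.\<close>
  define C where "C = max (2 * pi) (D * K)"
  show ?thesis
  proof (intro exI[of _ C] allI impI)
    fix q chi \<kappa> j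
    assume q: "q > 1" and prim: "primitive_dirichlet_character q chi" and \<kappa>: "\<kappa> \<in> {0, 1}"
      and par: "chi (-1) = (-1) ^ \<kappa>" and j: "(j::nat) \<ge> 1"
    interpret char_parity q chi \<kappa>
      using q prim \<kappa> par by unfold_locales (auto simp: primitive_dirichlet_character_def)
    \<comment> \<open>Both factors are bounded by the product, so a bound on \<open>j * q\<close>
      confines the modulus and the index to finite ranges.\<close>
    have "q \<le> j * q" "j \<le> j * q" using j q by auto
    have "1 < j * q" using q \<open>q \<le> j * q\<close> by (rule less_le_trans)
    then have jq: "real (j * q) > 1" by (simp del: of_nat_mult)
    then have l: "ln (real (j * q)) > 0" by (rule ln_gt_zero)
    show "cmod (L_deriv_zero chi \<kappa> j - (- 2 * of_nat j - of_nat \<kappa>)) \<le> C / ln (real (j * q))"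
    proof (cases "ln (real (j * q)) \<ge> K")
      case True
      then have "cmod (L_deriv_zero chi \<kappa> j - (- 2 * of_nat j - of_nat \<kappa>)) \<le> 2 * pi / ln (real (j * q))"
        using j by (intro L_deriv_zero_estimate) (simp_all add: K_def)
      also have "\<dots> \<le> C / ln (real (j * q))"
        using l by (intro divide_right_mono) (auto simp: C_def)
      finally show ?thesis .
    next
      case False
      then have "real (j * q) < exp K" using jq by (metis exp_less_mono exp_ln less_trans not_le zero_less_one)
      then have "j * q \<le> N" unfolding N_def by linarith
      then have "q \<le> N" "j \<le> N"
        using \<open>q \<le> j * q\<close> \<open>j \<le> j * q\<close> by (meson order_trans)+
      then have "q \<in> {2..N}" "j \<in> {1..N}" using q j by auto
      then have "(chi, \<kappa>, j) \<in> E"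
        using \<kappa> dirichlet unfolding E_def by blast
      then have d: "cmod (L_deriv_zero chi \<kappa> j - (- 2 * of_nat j - of_nat \<kappa>)) \<le> D"
        using D[of "(chi, \<kappa>, j)"] by (simp add: err_def)
      then have "0 \<le> D" by (meson norm_ge_zero order_trans)
      then have "D * ln (real (j * q)) \<le> D * K" using False by (intro mult_left_mono) auto
      then have "D \<le> C / ln (real (j * q))" using l by (simp add: C_def pos_le_divide_eq le_max_iff_disj)
      then show ?thesis using d by simp
    qed
  qed
qed

end
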